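(* Let $A$ be a pro-C*-algebra and let $E$ be a full right Hilbert $A$-module. If every derivation on $K_{A}(E)$ is inner, then every derivation on $L_{A}(E)$ is inner.
   Context: A pro-C*-algebra is a complete Hausdorff complex topological $*$-algebra $A$ whose topology is determined by its continuous C*-seminorms, i.e. a net $\{a_i\}$ converges to $0$ in $A$ if and only if $p(a_i)\to 0$ for every continuous C*-seminorm $p$ on $A$. $S(A)$ denotes the set of all continuous C*-seminorms on $A$. Algebras are not assumed to be unital. A right pre-Hilbert $A$-module is a right $A$-module $E$, compatible with the complex algebra structure of $A$, equipped with a map $\langle\cdot,\cdot\rangle_A:E\times E\to A$ that is $A$-linear in the second variable and satisfies $\langle x,y\rangle_A=\langle y,x\rangle_A^*$ and $\langle x,x\rangle_A\ge 0$ with equality if and only if $x=0$. It is a right Hilbert $A$-module if it is complete for the topology given by the seminorms $\overline{p}^{A}(\xi)=\sqrt{p(\langle \xi,\xi\rangle_A)}$, $p\in S(A)$. $E$ is full if the closure of the linear span of $\{\langle x,y\rangle_A: x,y\in E\}$ equals $A$. A map $T:E\to E$ is adjointable if there is a map $T^*:E\to E$ with $\langle Tx,y\rangle_A=\langle x,T^*y\rangle_A$ for all $x,y\in E$. $L_A(E)$ denotes the set of all adjointable ($A$-module, bounded with respect to each $\overline{p}^{A}$) maps on $E$; it is a pro-C*-algebra with the topology defined by the C*-seminorms $\tilde p(T)=\sup\{\overline{p}^{A}(Tx): x\in E,\ \overline{p}^{A}(x)\le 1\}$, $p\in S(A)$. For $x,y\in E$ let $\theta_{x,y}(\xi)=x\langle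 y,\xi\rangle_A$, $\xi\in E$. $K_A(E)$ is the closure in $L_A(E)$ of the linear span of $\{\theta_{x,y}:x,y\in E\}$; it is a pro-C*-subalgebra and a two-sided ideal of $L_A(E)$. A derivation on an algebra $B$ is a linear map $D:B\to B$ with $D(ab)=D(a)b+aD(b)$ for all $a,b\in B$ (no continuity is assumed). It is inner if there exists $x\in B$ such that $D(a)=ax-xa$ for every $a\in B$. *)

theory Defs
  imports "HOL-Analysis.Analysis" "HOL-Library.Function_Algebras"
begin

locale complex_star_algebra = vector_space scl
  for scl :: "complex \<Rightarrow> 'a::ring \<Rightarrow> 'a" +
  fixes star :: "'a \<Rightarrow> 'a"
  assumes scale_mult_left: "scl c (a * b) = scl c a * b"
    and scale_mult_right: "scl c (a * b) = a * scl c b"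
    and star_add: "star (a + b) = star a + star b"
    and star_scale: "star (scl c a) = scl (cnj c) (star a)"
    and star_mult: "star (a * b) = star b * star a"
    and star_star: "star (star a) = a"

definition cstar_seminorm ::
  "(complex \<Rightarrow> 'a::ring \<Rightarrow> 'a) \<Rightarrow> ('a \<Rightarrow> 'a) \<Rightarrow> ('a \<Rightarrow> real) \<Rightarrow> bool"
where
  "cstar_seminorm scl star p \<longleftrightarrow>
     (\<forall>a. 0 \<le> p a) \<and>
     (\<forall>a b. p (a + b) \<le> p a + p b) \<and>
     (\<forall>c a. p (scl c a) = cmod c * p a) \<and>
     (\<forall>a b. p (a * b) \<le> p a * p b) \<and>
     (\<forall>a. p (star a) = p a) \<and>
     (\<forall>a. p (star a * a) = (p a)\<^sup>2)"

text \<open>The set \<open>S(A)\<close>.\<close>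

definition continuous_cstar_seminorms ::
  "(complex \<Rightarrow> 'a::{ring,topological_space} \<Rightarrow> 'a) \<Rightarrow> ('a \<Rightarrow> 'a) \<Rightarrow> ('a \<Rightarrow> real) set"
where
  "continuous_cstar_seminorms scl star =
     {p. cstar_seminorm scl star p \<and> continuous_on UNIV p}"

text \<open>
  Addition and multiplication are continuous, and the topology is Hausdorff, by the sort
  constraint on \<open>'a\<close>. Uniform continuity of addition and negation forces the uniformity to be
  the canonical one of the topological group \<open>('a, +)\<close>, so that \<^const>\<open>complete\<close> is completeness
  of the topological vector space. Nets are rendered by filters.
\<close>

locale pro_cstar_algebra = complex_star_algebra scl star
  for scl ::
    "complex \<Rightarrow> 'a::{ring,topological_semigroup_mult,uniform_topological_group_add,t2_space} \<Rightarrow> 'a"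
  and star :: "'a \<Rightarrow> 'a" +
  assumes continuous_scale: "continuous_on UNIV (\<lambda>(c, a). scl c a)"
    and continuous_star: "continuous_on UNIV star"
    and complete_UNIV: "complete (UNIV :: 'a set)"
    and nhds_0_iff: "F \<le> nhds 0 \<longleftrightarrow>
          (\<forall>p\<in>continuous_cstar_seminorms scl star. (p \<longlongrightarrow> 0) F)"

text \<open>For algebras without unit: \<open>a \<ge> 0\<close> means \<open>a = b\<^sup>*b\<close> for some \<open>b\<close>.\<close>

definition positive_element :: "('a::ring \<Rightarrow> 'a) \<Rightarrow> 'a \<Rightarrow> bool" where
  "positive_element star a \<longleftrightarrow> (\<exists>b. a = star b * b)"

definition seminorms_complete :: "('e::ab_group_add \<Rightarrow> real) set \<Rightarrow> bool" where
  "seminorms_complete Q \<longleftrightarrow>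
     (\<forall>F. F \<noteq> bot \<and> (\<forall>q\<in>Q. ((\<lambda>(x, y). q (x - y)) \<longlongrightarrow> 0) (F \<times>\<^sub>F F)) \<longrightarrow>
          (\<exists>x. \<forall>q\<in>Q. ((\<lambda>y. q (y - x)) \<longlongrightarrow> 0) F))"

definition module_seminorm :: "('e \<Rightarrow> 'e \<Rightarrow> 'a) \<Rightarrow> ('a \<Rightarrow> real) \<Rightarrow> 'e \<Rightarrow> real" where
  "module_seminorm ip p \<xi> = sqrt (p (ip \<xi> \<xi>))"

locale right_hilbert_module =
  A: pro_cstar_algebra scaleA star + E: vector_space scaleE
  for scaleA ::
    "complex \<Rightarrow> 'a::{ring,topological_semigroup_mult,uniform_topological_group_add,t2_space} \<Rightarrow> 'a"
  and star :: "'a \<Rightarrow> 'a"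
  and scaleE :: "complex \<Rightarrow> 'e::ab_group_add \<Rightarrow> 'e" +
  fixes act :: "'e \<Rightarrow> 'a \<Rightarrow> 'e"
    and ip :: "'e \<Rightarrow> 'e \<Rightarrow> 'a"
  assumes act_add_left: "act (x + y) a = act x a + act y a"
    and act_add_right: "act x (a + b) = act x a + act x b"
    and act_mult: "act x (a * b) = act (act x a) b"
    and act_scale_left: "act (scaleE c x) a = scaleE c (act x a)"
    and act_scale_right: "act x (scaleA c a) = scaleE c (act x a)"
    and ip_add_right: "ip x (y + z) = ip x y + ip x z"
    and ip_scale_right: "ip x (scaleE c y) = scaleA c (ip x y)"
    and ip_act_right: "ip x (act y a) = ip x y * a"
    and ip_star: "ip x y = star (ip y x)"
    and ip_positive: "positive_element star (ip x x)"
    and ip_eq_0_iff: "ip x x = 0 \<longleftrightarrow> x = 0"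
    and complete_E:
      "seminorms_complete (module_seminorm ip ` continuous_cstar_seminorms scaleA star)"

definition full_module ::
  "(complex \<Rightarrow> 'a::{ring,topological_space} \<Rightarrow> 'a) \<Rightarrow> ('e \<Rightarrow> 'e \<Rightarrow> 'a) \<Rightarrow> bool"
where
  "full_module scaleA ip \<longleftrightarrow>
     closure (module.span scaleA {ip x y | x y. True}) = UNIV"

definition adjointable :: "('e \<Rightarrow> 'e \<Rightarrow> 'a) \<Rightarrow> ('e \<Rightarrow> 'e) \<Rightarrow> bool" where
  "adjointable ip T \<longleftrightarrow> (\<exists>T'. \<forall>x y. ip (T x) y = ip x (T' y))"

text \<open>\<open>L\<^sub>A(E)\<close> and, below, \<open>K\<^sub>A(E)\<close>; their multiplication is composition of maps.\<close>

definition adjointable_operators ::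
  "(complex \<Rightarrow> 'a::{ring,topological_space} \<Rightarrow> 'a) \<Rightarrow> ('a \<Rightarrow> 'a) \<Rightarrow>
   (complex \<Rightarrow> 'e::ab_group_add \<Rightarrow> 'e) \<Rightarrow> ('e \<Rightarrow> 'a \<Rightarrow> 'e) \<Rightarrow> ('e \<Rightarrow> 'e \<Rightarrow> 'a) \<Rightarrow> ('e \<Rightarrow> 'e) set"
where
  "adjointable_operators scaleA star scaleE act ip =
     {T. adjointable ip T \<and>
         (\<forall>x y. T (x + y) = T x + T y) \<and>
         (\<forall>c x. T (scaleE c x) = scaleE c (T x)) \<and>
         (\<forall>x a. T (act x a) = act (T x) a) \<and>
         (\<forall>p\<in>continuous_cstar_seminorms scaleA star.
            \<exists>M. \<forall>x. module_seminorm ip p (T x) \<le> M * module_seminorm ip p x)}"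

definition operator_seminorm ::
  "('e \<Rightarrow> 'e \<Rightarrow> 'a) \<Rightarrow> ('a \<Rightarrow> real) \<Rightarrow> ('e \<Rightarrow> 'e) \<Rightarrow> real"
where
  "operator_seminorm ip p T =
     (SUP x\<in>{x. module_seminorm ip p x \<le> 1}. module_seminorm ip p (T x))"

definition operator_topology ::
  "(complex \<Rightarrow> 'a::{ring,topological_space} \<Rightarrow> 'a) \<Rightarrow> ('a \<Rightarrow> 'a) \<Rightarrow>
   (complex \<Rightarrow> 'e::ab_group_add \<Rightarrow> 'e) \<Rightarrow> ('e \<Rightarrow> 'a \<Rightarrow> 'e) \<Rightarrow> ('e \<Rightarrow> 'e \<Rightarrow> 'a) \<Rightarrow>
   ('e \<Rightarrow> 'e) topology"
where
  "operator_topology scaleA star scaleE act ip =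
     (let L = adjointable_operators scaleA star scaleE act ip in
      topology_generated_by
        {{U \<in> L. operator_seminorm ip p (U - T) < \<epsilon>} | p T \<epsilon>.
           p \<in> continuous_cstar_seminorms scaleA star \<and> T \<in> L \<and> 0 < \<epsilon>})"

definition rank_one :: "('e \<Rightarrow> 'a \<Rightarrow> 'e) \<Rightarrow> ('e \<Rightarrow> 'e \<Rightarrow> 'a) \<Rightarrow> 'e \<Rightarrow> 'e \<Rightarrow> 'e \<Rightarrow> 'e" where
  "rank_one act ip x y = (\<lambda>\<xi>. act x (ip y \<xi>))"

definition scale_map :: "(complex \<Rightarrow> 'e \<Rightarrow> 'e) \<Rightarrow> complex \<Rightarrow> ('e \<Rightarrow> 'e) \<Rightarrow> ('e \<Rightarrow> 'e)" where
  "scale_map scaleE c T = (\<lambda>x. scaleE c (T x))"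

definition compact_operators ::
  "(complex \<Rightarrow> 'a::{ring,topological_space} \<Rightarrow> 'a) \<Rightarrow> ('a \<Rightarrow> 'a) \<Rightarrow>
   (complex \<Rightarrow> 'e::ab_group_add \<Rightarrow> 'e) \<Rightarrow> ('e \<Rightarrow> 'a \<Rightarrow> 'e) \<Rightarrow> ('e \<Rightarrow> 'e \<Rightarrow> 'a) \<Rightarrow> ('e \<Rightarrow> 'e) set"
where
  "compact_operators scaleA star scaleE act ip =
     operator_topology scaleA star scaleE act ip
       closure_of module.span (scale_map scaleE) {rank_one act ip x y | x y. True}"

text \<open>
  Derivations of an algebra with carrier \<open>B\<close>, scalar multiplication \<open>scl\<close> and multiplication
  \<open>prd\<close>; only the restriction of \<open>D\<close> to \<open>B\<close> is relevant.
\<close>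

definition derivation_on ::
  "(complex \<Rightarrow> 'b::ab_group_add \<Rightarrow> 'b) \<Rightarrow> ('b \<Rightarrow> 'b \<Rightarrow> 'b) \<Rightarrow> 'b set \<Rightarrow> ('b \<Rightarrow> 'b) \<Rightarrow> bool"
where
  "derivation_on scl prd B D \<longleftrightarrow>
     (\<forall>a\<in>B. D a \<in> B) \<and>
     (\<forall>a\<in>B. \<forall>b\<in>B. D (a + b) = D a + D b) \<and>
     (\<forall>c. \<forall>a\<in>B. D (scl c a) = scl c (D a)) \<and>
     (\<forall>a\<in>B. \<forall>b\<in>B. D (prd a b) = prd (D a) b + prd a (D b))"

definition inner_on ::
  "('b::ab_group_add \<Rightarrow> 'b \<Rightarrow> 'b) \<Rightarrow> 'b set \<Rightarrow> ('b \<Rightarrow> 'b) \<Rightarrow> bool"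
where
  "inner_on prd B D \<longleftrightarrow> (\<exists>x\<in>B. \<forall>a\<in>B. D a = prd a x - prd x a)"

end

theory Submission
  imports Defs "HOL-Computational_Algebra.Polynomial"
begin

text \<open>
  Let \<open>D\<close> be a derivation of \<open>L(E)\<close>. Every self-adjoint \<open>h\<close> in \<open>K(E)\<close> has a cube root \<open>a\<close> in
  \<open>K(E)\<close> (\<open>compact_cube_root\<close>), so that \<open>D h = D(a) a\<^sup>2 + a D(a\<^sup>2)\<close> lies in the ideal \<open>K(E)\<close>. Hence
  \<open>D\<close> restricts to a derivation of \<open>K(E)\<close>, without any continuity of \<open>D\<close>
  (\<open>derivation_preserves_K\<close>). If the restriction is \<open>k \<mapsto> k x - x k\<close>, then expanding \<open>D(T k)\<close> in two
  ways shows that \<open>(D(T) - (T x - x T)) k = 0\<close> for all \<open>k\<close> in \<open>K(E)\<close>. An operator that kills all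
  rank one operators on the left is zero, because \<open>\<langle>S \<xi>, S \<xi>\<rangle>\<^sup>2 = 0\<close> for all \<open>\<xi>\<close>.

  Most of the work is the analysis behind the cube root: the \<open>C\<^sup>*\<close>-theory of a single seminorm, by
  elementary means. Fix a self-adjoint element \<open>h\<close> and let \<open>q f = \<parallel>f(h)\<parallel>\<close> for real polynomials
  \<open>f\<close>. If \<open>\<parallel>h\<parallel> < M\<close>, then \<open>q f \<le> sup \<bar>f\<bar>\<close> over \<open>[-M, M]\<close> (\<open>q_le_sup\<close>). To see this, write \<open>f\<close> as
  a combination of the Chebyshev polynomials of \<open>a = h / M\<close>. Their norms are at most \<open>1\<close> by
  the Pell identity \<open>T\<^sub>k(a)\<^sup>2 + (1 - a\<^sup>2) U\<^sub>k\<^sub>-\<^sub>1(a)\<^sup>2 = 1\<close>, as \<open>1 - a\<^sup>2\<close> is almost a square, and their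
  coefficients are bounded by \<open>2 sup \<bar>f\<bar>\<close>; the resulting factor \<open>2 (deg f + 1)\<close> disappears
  when \<open>f\<close> is replaced by its \<open>2\<^sup>n\<close>-th powers. A compactness argument then shows that \<open>q\<close> is the
  supremum over a compact spectrum (\<open>spectrum_exists\<close>). For the algebra \<open>A\<close> acting on itself, this
  gives the positivity of \<open>b\<^sup>*b\<close> (\<open>spectrum_ge_star_mult\<close>), hence the monotonicity
  \<open>\<parallel>a\<^sup>*a\<parallel> \<le> \<parallel>a\<^sup>*a + b\<^sup>*b\<parallel>\<close> and the Cauchy-Schwarz inequality in \<open>E\<close>. For operators on \<open>E\<close>, it shows
  that polynomials approximating the real cube root converge at \<open>h\<close> in every seminorm.
\<close>

section \<open>Chebyshev polynomials and Fourier coefficients\<close>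

text \<open>
  The Chebyshev polynomials of the first kind, and those of the second kind with index shifted
  by one, evaluated at an element of a commutative ring: for \<open>a = cos \<theta>\<close> the values are
  \<open>cos (k \<theta>)\<close> and \<open>sin (k \<theta>) / sin \<theta>\<close>.
\<close>

fun cheb1 cheb2 :: "'a::comm_ring_1 \<Rightarrow> nat \<Rightarrow> 'a" where
  "cheb1 a 0 = 1"
| "cheb1 a (Suc k) = a * cheb1 a k - (1 - a\<^sup>2) * cheb2 a k"
| "cheb2 a 0 = 0"
| "cheb2 a (Suc k) = cheb1 a k + a * cheb2 a k"

lemma cheb_pell: "(cheb1 a k)\<^sup>2 + (1 - a\<^sup>2) * (cheb2 a k)\<^sup>2 = 1"
proof (induction k)
  case (Suc k)
  have "(cheb1 a (Suc k))\<^sup>2 + (1 - a\<^sup>2) * (cheb2 a (Suc k))\<^sup>2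
      = (cheb1 a k)\<^sup>2 + (1 - a\<^sup>2) * (cheb2 a k)\<^sup>2"
    by (simp add: algebra_simps power2_eq_square)
  then show ?case using Suc by simp
qed simp

lemma cheb1_recurrence: "a * cheb1 a (Suc k) + a * cheb1 a (Suc k) = cheb1 a (Suc (Suc k)) + cheb1 a k"
  by (simp add: algebra_simps power2_eq_square)

lemma cheb_cos: "cheb1 (cos \<theta>) k = cos (real k * \<theta>) \<and> cheb2 (cos \<theta>) k * sin \<theta> = sin (real k * \<theta>)"
proof (induction k)
  case (Suc k)
  have s: "1 - (cos \<theta>)\<^sup>2 = sin \<theta> * sin \<theta>"
    using sin_cos_squared_add[of \<theta>] by (simp add: power2_eq_square)
  have "cheb1 (cos \<theta>) (Suc k) = cos \<theta> * cos (real k * \<theta>) - sin \<theta> * (cheb2 (cos \<theta>) k * sin \<theta>)"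
    using Suc by (simp add: s mult.commute mult.left_commute del: mult_cancel_left mult_cancel_right)
  also have "\<dots> = cos \<theta> * cos (real k * \<theta>) - sin \<theta> * sin (real k * \<theta>)"
    using Suc by simp
  also have "\<dots> = cos (real (Suc k) * \<theta>)"
    by (simp add: cos_add[symmetric] algebra_simps)
  finally have 1: "cheb1 (cos \<theta>) (Suc k) = cos (real (Suc k) * \<theta>)" .
  have "cheb2 (cos \<theta>) (Suc k) * sin \<theta> = cos (real k * \<theta>) * sin \<theta> + cos \<theta> * (cheb2 (cos \<theta>) k * sin \<theta>)"
    using Suc by (simp add: algebra_simps)
  also have "\<dots> = cos (real k * \<theta>) * sin \<theta> + cos \<theta> * sin (real k * \<theta>)"
    using Suc by simp
  also have "\<dots> = sin (real (Suc k) * \<theta>)"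
    by (simp add: algebra_simps sin_add)
  finally show ?case using 1 by blast
qed simp

lemma poly_cheb: "poly (cheb1 P k) t = cheb1 (poly P t) k \<and> poly (cheb2 P k) t = cheb2 (poly P t) k"
  by (induction k) auto

text \<open>Every polynomial is a combination of Chebyshev polynomials of the rescaled variable
  \<open>t / M\<close>.\<close>

lemma chebyshev_expansion:
  fixes f :: "real poly"
  assumes "M > 0" "degree f \<le> d"
  shows "\<exists>c. f = (\<Sum>k\<le>d. smult (c k) (cheb1 [:0, 1 / M:] k))"
  using assms(2)
proof (induction f arbitrary: d)
  case 0
  show ?case by (rule exI[of _ "\<lambda>_. 0"]) simp
next
  case (pCons a f)
  let ?T = "cheb1 [:0, 1 / M:] :: nat \<Rightarrow> real poly"
  define S where "S n = {f. \<exists>c. f = (\<Sum>k\<le>n. smult (c k) (?T k))}" for n :: nat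
  have S_add: "f + g \<in> S n" if "f \<in> S n" "g \<in> S n" for f g n
  proof -
    obtain b c where "f = (\<Sum>k\<le>n. smult (b k) (?T k))" "g = (\<Sum>k\<le>n. smult (c k) (?T k))"
      using \<open>f \<in> S n\<close> \<open>g \<in> S n\<close> unfolding S_def by blast
    then have "f + g = (\<Sum>k\<le>n. smult (b k + c k) (?T k))"
      by (simp add: smult_add_left sum.distrib)
    then show ?thesis unfolding S_def by (intro CollectI exI)
  qed
  have S_smult: "smult r f \<in> S n" if "f \<in> S n" for f n r
  proof -
    obtain b where "f = (\<Sum>k\<le>n. smult (b k) (?T k))"
      using \<open>f \<in> S n\<close> unfolding S_def by blast
    then have "smult r f = (\<Sum>k\<le>n. smult (r * b k) (?T k))"
      using sum_distrib_left[of "[:r:]" "\<lambda>k. smult (b k) (?T k)" "{..n}"] by (simp add: mult.commute)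
    then show ?thesis unfolding S_def by (intro CollectI exI)
  qed
  have S_base: "?T j \<in> S n" if "j \<le> n" for j n
  proof -
    have "(\<Sum>k\<le>n. smult (if k = j then 1 else 0) (?T k)) = (\<Sum>k\<le>n. if k = j then ?T k else 0)"
      by (intro sum.cong) auto
    also have "\<dots> = ?T j" using that by simp
    finally show ?thesis unfolding S_def by (intro CollectI exI) (rule sym)
  qed
  have S_sum: "(\<Sum>i\<in>I. g i) \<in> S n" if "finite I" "\<And>i. i \<in> I \<Longrightarrow> g i \<in> S n" for I :: "nat set" and g n
    using that
  proof (induction I rule: finite_induct)
    case empty
    have "smult 0 (?T 0) \<in> S n" by (rule S_smult, rule S_base) simp
    then show ?case by simp
  qed (auto intro: S_add)
  have mult: "[:0, 1 / M:] * ?T k \<in> S (Suc n)" if "k \<le> n" for k n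
  proof (cases k)
    case 0
    have "[:0, 1 / M:] * ?T 0 = ?T 1" by simp
    then show ?thesis using S_base[of 1 "Suc n"] 0 by simp
  next
    case (Suc j)
    have half: "smult (1 / 2) (u + u) = u" for u :: "real poly"
      using smult_add_left[of "1 / 2" "1 / 2" u] by (simp add: smult_add_right)
    have "[:0, 1 / M:] * ?T (Suc j) = smult (1 / 2) (?T (Suc (Suc j)) + ?T j)"
      unfolding cheb1_recurrence[symmetric] half ..
    moreover have "smult (1 / 2) (?T (Suc (Suc j)) + ?T j) \<in> S (Suc n)"
      using Suc that by (intro S_smult S_add S_base) auto
    ultimately show ?thesis unfolding Suc by (simp only:)
  qed
  show ?case
  proof (cases "f = 0")
    case True
    have "smult a (?T 0) \<in> S d" by (intro S_smult S_base) simp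
    then show ?thesis using True unfolding S_def by (simp add: mult.commute)
  next
    case False
    then obtain n where d: "d = Suc n" and "degree f \<le> n"
      using pCons.prems by (cases d) auto
    then obtain c where c: "f = (\<Sum>k\<le>n. smult (c k) (?T k))" using pCons.IH by blast
    have "pCons a f = smult a (?T 0) + smult M ([:0, 1 / M:] * f)"
      using \<open>M > 0\<close> by simp
    also have "[:0, 1 / M:] * f = (\<Sum>k\<le>n. smult (c k) ([:0, 1 / M:] * ?T k))"
      by (subst c, subst sum_distrib_left, simp only: mult_smult_right)
    finally have eq: "pCons a f = smult a (?T 0) + smult M (\<Sum>k\<le>n. smult (c k) ([:0, 1 / M:] * ?T k))" .
    have "pCons a f \<in> S d"
      unfolding eq d by (intro S_add S_smult S_sum S_base mult) simp_all
    then show ?thesis unfolding S_def by blast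
  qed
qed

lemma integral_cos_multiple:
  fixes m :: int
  shows "((\<lambda>t. cos (of_int m * t)) has_integral (if m = 0 then 2 * pi else 0)) {0..2*pi}"
proof (cases "m = 0")
  case True
  then show ?thesis using has_integral_const_real[of "1::real" 0 "2*pi"] by simp
next
  case False
  have "((\<lambda>t. cos (of_int m * t)) has_integral
      (sin (of_int m * (2 * pi)) / of_int m - sin (of_int m * 0) / of_int m)) {0..2*pi}"
    using False
    by (intro fundamental_theorem_of_calculus)
       (auto intro!: derivative_eq_intros simp: has_real_derivative_iff_has_vector_derivative[symmetric])
  moreover have "sin (of_int m * (2 * pi)) = 0"
    using sin_int_2pin[of m] by (simp add: mult.commute mult.left_commute)
  ultimately show ?thesis using False by simp
qed

lemma cosine_coefficient_bound:
  fixes c :: "nat \<Rightarrow> real"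
  assumes bound: "\<And>\<theta>. \<bar>\<Sum>k\<le>d. c k * cos (real k * \<theta>)\<bar> \<le> C" and "j \<le> d"
  shows "\<bar>c j\<bar> \<le> 2 * C"
proof -
  define I where "I = (\<lambda>k::nat. if k = j then (if j = 0 then 2 * pi else pi) else 0)"
  have I: "((\<lambda>t. cos (real k * t) * cos (real j * t)) has_integral I k) {0..2*pi}" for k
  proof -
    have "((\<lambda>t. (cos (of_int (int k - int j) * t) + cos (of_int (int k + int j) * t)) / 2) has_integral
       ((if int k - int j = 0 then 2 * pi else 0) + (if int k + int j = 0 then 2 * pi else 0)) / 2) {0..2*pi}"
      by (intro has_integral_divide has_integral_add integral_cos_multiple)
    moreover have "((if int k - int j = 0 then 2 * pi else 0) + (if int k + int j = 0 then 2 * pi else 0)) / 2 = I k"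
      unfolding I_def by auto
    moreover have "(cos (of_int (int k - int j) * t) + cos (of_int (int k + int j) * t)) / 2
      = cos (real k * t) * cos (real j * t)" for t
      by (simp add: cos_times_cos left_diff_distrib distrib_right)
    ultimately show ?thesis by simp
  qed
  have "((\<lambda>t. \<Sum>k\<le>d. c k * (cos (real k * t) * cos (real j * t))) has_integral (\<Sum>k\<le>d. c k * I k)) {0..2*pi}"
    by (intro has_integral_sum has_integral_mult_right I) auto
  moreover have "(\<Sum>k\<le>d. c k * I k) = (\<Sum>k\<le>d. if k = j then c j * I j else 0)"
    by (intro sum.cong) (auto simp: I_def)
  moreover have "\<dots> = c j * I j" using \<open>j \<le> d\<close> by simp
  ultimately have "((\<lambda>t. \<Sum>k\<le>d. c k * (cos (real k * t) * cos (real j * t))) has_integral c j * I j) {0..2*pi}"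
    by simp
  moreover have "norm (\<Sum>k\<le>d. c k * (cos (real k * t) * cos (real j * t))) \<le> C" for t
  proof -
    have "norm (\<Sum>k\<le>d. c k * (cos (real k * t) * cos (real j * t)))
        = \<bar>\<Sum>k\<le>d. c k * cos (real k * t)\<bar> * \<bar>cos (real j * t)\<bar>"
      by (simp add: sum_distrib_right mult.assoc abs_mult[symmetric])
    also have "\<dots> \<le> C * 1"
      using bound[of t] by (intro mult_mono) (auto intro: order_trans[OF abs_ge_zero])
    finally show ?thesis by simp
  qed
  moreover have "0 \<le> C" using bound[of 0] by linarith
  ultimately have "norm (c j * I j) \<le> C * measure lborel (cbox 0 (2*pi))"
    using has_integral_bound[of C "\<lambda>t. \<Sum>k\<le>d. c k * (cos (real k * t) * cos (real j * t))" "c j * I j" 0 "2*pi"]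
    by (simp add: cbox_interval)
  then have 1: "\<bar>c j\<bar> * \<bar>I j\<bar> \<le> C * (2 * pi)" by (simp add: abs_mult)
  have "\<bar>c j\<bar> * pi \<le> \<bar>c j\<bar> * \<bar>I j\<bar>"
    by (intro mult_left_mono) (auto simp: I_def)
  also have "\<dots> \<le> C * (2 * pi)" by (rule 1)
  finally have "\<bar>c j\<bar> * pi \<le> (2 * C) * pi" by (simp only: mult_ac)
  then show ?thesis using pi_gt_zero mult_le_cancel_right_pos by blast
qed

lemma Weierstrass_poly:
  fixes g :: "real \<Rightarrow> real"
  assumes "continuous_on {a..b} g" "e > 0"
  shows "\<exists>P :: real poly. \<forall>t\<in>{a..b}. \<bar>poly P t - g t\<bar> < e"
proof -
  obtain h where h: "real_polynomial_function h" "\<And>x. x \<in> {a..b} \<Longrightarrow> \<bar>g x - h x\<bar> < e"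
    using Stone_Weierstrass_real_polynomial_function[OF compact_Icc assms] by blast
  then obtain c n where hc: "h = (\<lambda>x. \<Sum>i\<le>n. c i * x ^ i)"
    by (auto simp: real_polynomial_function_iff_sum)
  have "poly (\<Sum>i\<le>n. monom (c i) i) t = h t" for t
    by (simp add: hc poly_sum poly_monom)
  then have "\<forall>t\<in>{a..b}. \<bar>poly (\<Sum>i\<le>n. monom (c i) i) t - g t\<bar> < e"
    using h(2) by (metis abs_minus_commute)
  then show ?thesis by blast
qed

section \<open>Seminorms on real polynomials and their spectra\<close>

text \<open>
  The seminorms \<open>f \<mapsto> \<parallel>f(h)\<parallel>\<close> that come from a self-adjoint element \<open>h\<close>. The inequality
  \<open>q_square\<close> is what remains of the C*-identity
  \<open>\<parallel>f(h) + i g(h)\<parallel>\<^sup>2 = \<parallel>f(h)\<^sup>2 + g(h)\<^sup>2\<parallel>\<close> when only real coefficients are used.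
\<close>

locale poly_cstar_seminorm =
  fixes q :: "real poly \<Rightarrow> real"
  assumes q_add: "q (f + g) \<le> q f + q g"
    and q_smult: "q (smult c f) = \<bar>c\<bar> * q f"
    and q_mult: "q (f * g) \<le> q f * q g"
    and q_square: "(q f)\<^sup>2 \<le> q (f\<^sup>2 + g\<^sup>2)"
    and q_one: "q 1 \<le> 1"
begin

lemma q_zero: "q 0 = 0"
  using q_smult[of 0 0] by simp

lemma q_minus: "q (- f) = q f"
  using q_smult[of "-1" f] by simp

lemma q_nonneg: "0 \<le> q f"
  using q_add[of f "- f"] by (simp add: q_zero q_minus)

lemma q_sum: "finite I \<Longrightarrow> q (\<Sum>i\<in>I. g i) \<le> (\<Sum>i\<in>I. q (g i))"
  by (induction I rule: finite_induct) (auto simp: q_zero intro: order_trans[OF q_add])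

lemma q_power: "q (f ^ n) \<le> q f ^ n"
  by (induction n) (auto simp: q_one intro!: order_trans[OF q_mult] mult_left_mono q_nonneg)

lemma q_power2: "q (f\<^sup>2) = (q f)\<^sup>2"
  using q_square[of f 0] q_power[of f 2] by simp

lemma q_power_2_power: "q (f ^ (2 ^ n)) = q f ^ (2 ^ n)"
proof (induction n)
  case (Suc n)
  have "q (f ^ (2 ^ Suc n)) = q ((f ^ (2 ^ n))\<^sup>2)"
    by (simp add: power_mult[symmetric] mult.commute)
  also have "\<dots> = (q f ^ (2 ^ n))\<^sup>2" using q_power2 Suc by simp
  finally show ?case by (simp add: power_mult[symmetric] mult.commute)
qed simp

text \<open>
  An approximate square root of \<open>1 - a\<^sup>2\<close> is \<open>1 - r\<close>, where \<open>r\<close> is almost a fixed point of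
  \<open>r \<mapsto> (a\<^sup>2 + r\<^sup>2) / 2\<close>; this map is a contraction on \<open>q r \<le> q a < 1\<close>.
\<close>

lemma sqrt_approximation:
  assumes a: "q a < 1" and "e > 0"
  shows "\<exists>s. q (s\<^sup>2 + a\<^sup>2 - 1) \<le> e"
proof -
  define r where "r = rec_nat (0 :: real poly) (\<lambda>_ u. smult (1 / 2) (a\<^sup>2 + u\<^sup>2))"
  have r0: "r 0 = 0" and rS: "\<And>n. r (Suc n) = smult (1 / 2) (a\<^sup>2 + (r n)\<^sup>2)"
    by (simp_all add: r_def)
  let ?\<rho> = "q a"
  have sq: "?\<rho>\<^sup>2 \<le> ?\<rho>"
    using a q_nonneg[of a] by (simp add: power2_eq_square mult_left_le)
  have r_le: "q (r n) \<le> ?\<rho>" for n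
  proof (induction n)
    case (Suc n)
    have "q (r (Suc n)) = (1 / 2) * q (a\<^sup>2 + (r n)\<^sup>2)" by (simp add: rS q_smult)
    also have "\<dots> \<le> (1 / 2) * (?\<rho>\<^sup>2 + (q (r n))\<^sup>2)"
      using q_add[of "a\<^sup>2" "(r n)\<^sup>2"] by (simp add: q_power2)
    also have "\<dots> \<le> (1 / 2) * (?\<rho>\<^sup>2 + ?\<rho>\<^sup>2)"
      using Suc q_nonneg by (intro mult_left_mono add_left_mono power_mono) auto
    finally show ?case using sq by simp
  qed (simp add: r0 q_zero q_nonneg)
  have r_diff: "q (r (Suc n) - r n) \<le> ?\<rho> ^ n" for n
  proof (induction n)
    case 0
    have "q (r (Suc 0) - r 0) = (1 / 2) * ?\<rho>\<^sup>2"
      by (simp add: rS r0 q_smult q_power2)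
    then show ?case using sq a by simp
  next
    case (Suc n)
    have "r (Suc (Suc n)) - r (Suc n) = smult (1 / 2) (a\<^sup>2 + (r (Suc n))\<^sup>2) - smult (1 / 2) (a\<^sup>2 + (r n)\<^sup>2)"
      by (simp only: rS)
    also have "\<dots> = smult (1 / 2) ((r (Suc n) - r n) * (r (Suc n) + r n))"
      by (simp only: smult_diff_right[symmetric]) (simp add: algebra_simps power2_eq_square)
    finally have "r (Suc (Suc n)) - r (Suc n) = smult (1 / 2) ((r (Suc n) - r n) * (r (Suc n) + r n))" .
    then have "q (r (Suc (Suc n)) - r (Suc n)) = (1 / 2) * q ((r (Suc n) - r n) * (r (Suc n) + r n))"
      by (simp add: q_smult)
    also have "\<dots> \<le> (1 / 2) * (?\<rho> ^ n * (?\<rho> + ?\<rho>))"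
      using Suc r_le[of n] r_le[of "Suc n"] q_add[of "r (Suc n)" "r n"] q_nonneg
      by (intro mult_left_mono order_trans[OF q_mult] mult_mono) (auto simp: q_nonneg)
    finally show ?case by (simp add: mult.commute)
  qed
  obtain n where n: "?\<rho> ^ n < e / 2"
    using real_arch_pow_inv[of "e / 2" ?\<rho>] a \<open>e > 0\<close> by auto
  have two: "smult 2 u = u + u" for u :: "real poly"
    using smult_add_left[of 1 1 u] by simp
  have "(1 - r n)\<^sup>2 + a\<^sup>2 - 1 = smult 2 (r (Suc n) - r n)"
    by (simp add: rS smult_diff_right power2_eq_square algebra_simps two)
  then have "q ((1 - r n)\<^sup>2 + a\<^sup>2 - 1) = 2 * q (r (Suc n) - r n)" by (simp add: q_smult)
  then show ?thesis using r_diff[of n] n by (intro exI[of _ "1 - r n"]) linarith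
qed

lemma q_cheb1:
  assumes "q a < 1"
  shows "q (cheb1 a k) \<le> 1"
proof -
  have "(q (cheb1 a k))\<^sup>2 \<le> 1 + e" if "e > 0" for e
  proof -
    let ?K = "q ((cheb2 a k)\<^sup>2)"
    have "0 < e / (?K + 1)" using that q_nonneg[of "(cheb2 a k)\<^sup>2"] by simp
    then obtain s where s: "q (s\<^sup>2 + a\<^sup>2 - 1) \<le> e / (?K + 1)"
      using sqrt_approximation[OF assms] by blast
    have "(cheb1 a k)\<^sup>2 + (s * cheb2 a k)\<^sup>2 = 1 + (s\<^sup>2 + a\<^sup>2 - 1) * (cheb2 a k)\<^sup>2"
      using cheb_pell[of a k] by algebra
    then have "(q (cheb1 a k))\<^sup>2 \<le> q (1 + (s\<^sup>2 + a\<^sup>2 - 1) * (cheb2 a k)\<^sup>2)"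
      using q_square[of "cheb1 a k" "s * cheb2 a k"] by simp
    also have "\<dots> \<le> 1 + q (s\<^sup>2 + a\<^sup>2 - 1) * ?K"
      by (meson add_mono order_trans q_add q_mult q_one)
    also have "q (s\<^sup>2 + a\<^sup>2 - 1) * ?K \<le> e / (?K + 1) * (?K + 1)"
      using s q_nonneg[of "(cheb2 a k)\<^sup>2"] that by (intro mult_mono) (auto simp: q_nonneg)
    finally show ?thesis using q_nonneg[of "(cheb2 a k)\<^sup>2"] by auto
  qed
  then have "(q (cheb1 a k))\<^sup>2 \<le> 1" by (rule field_le_epsilon)
  then show ?thesis by (simp add: power_le_one_iff abs_square_le_1 q_nonneg)
qed

text \<open>
  Up to the factor \<open>2 (d + 1)\<close>, this is the bound \<open>q_le_sup\<close> below: the Chebyshev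
  coefficients of \<open>f\<close> are the Fourier coefficients of \<open>f (M cos \<theta>)\<close>.
\<close>

lemma q_le_degree:
  assumes M: "q [:0, 1:] < M" and C: "\<And>t. \<bar>t\<bar> \<le> M \<Longrightarrow> \<bar>poly f t\<bar> \<le> C" and d: "degree f \<le> d"
  shows "q f \<le> (real d + 1) * (2 * C)"
proof -
  have "M > 0" using M q_nonneg[of "[:0, 1:]"] by linarith
  obtain c where c: "f = (\<Sum>k\<le>d. smult (c k) (cheb1 [:0, 1 / M:] k))"
    using chebyshev_expansion[OF \<open>M > 0\<close> d] by blast
  have "[:0, 1 / M:] = smult (1 / M) [:0, 1:]" by simp
  then have a: "q [:0, 1 / M:] < 1" using M \<open>M > 0\<close> by (simp only: q_smult) simp
  have cb: "\<bar>c k\<bar> \<le> 2 * C" if "k \<le> d" for k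
  proof (rule cosine_coefficient_bound[OF _ that])
    fix \<theta> :: real
    have "poly f (M * cos \<theta>) = (\<Sum>k\<le>d. c k * cos (real k * \<theta>))"
      using \<open>M > 0\<close> by (subst c) (simp add: poly_sum poly_cheb cheb_cos)
    moreover have "\<bar>M * cos \<theta>\<bar> \<le> M" using \<open>M > 0\<close> by (simp add: abs_mult)
    ultimately show "\<bar>\<Sum>k\<le>d. c k * cos (real k * \<theta>)\<bar> \<le> C" using C[of "M * cos \<theta>"] by simp
  qed
  have "q f \<le> (\<Sum>k\<le>d. q (smult (c k) (cheb1 [:0, 1 / M:] k)))"
    by (subst c) (rule q_sum, simp)
  also have "\<dots> \<le> (\<Sum>k\<le>d. 2 * C)"
  proof (rule sum_mono)
    fix k assume "k \<in> {..d}"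
    then have "\<bar>c k\<bar> * q (cheb1 [:0, 1 / M:] k) \<le> (2 * C) * 1"
      using cb[of k] q_cheb1[OF a] q_nonneg by (intro mult_mono) auto
    then show "q (smult (c k) (cheb1 [:0, 1 / M:] k)) \<le> 2 * C" by (simp add: q_smult)
  qed
  finally show ?thesis by (simp add: add.commute)
qed

text \<open>The factor disappears when \<open>f\<close> is replaced by its powers \<open>f ^ (2 ^ n)\<close>.\<close>

lemma q_le_sup:
  assumes M: "q [:0, 1:] < M" and C: "\<And>t. \<bar>t\<bar> \<le> M \<Longrightarrow> \<bar>poly f t\<bar> \<le> C"
  shows "q f \<le> C"
proof (rule ccontr)
  assume "\<not> q f \<le> C"
  then have less: "C < q f" by simp
  have "M > 0" using M q_nonneg[of "[:0, 1:]"] by linarith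
  then have "C \<ge> 0" using C[of 0] by simp
  obtain C' where C': "C < C'" "C' < q f" using dense[OF less] by blast
  define \<rho> where "\<rho> = q f / C'"
  have "C' > 0" using C' \<open>C \<ge> 0\<close> by linarith
  then have \<rho>: "\<rho> > 1" using C' by (simp add: \<rho>_def)
  have bound: "\<rho> ^ (2 ^ n) \<le> (real (degree f) * real (2 ^ n) + 1) * 2" for n
  proof -
    have "q (f ^ (2 ^ n)) \<le> (real (degree f * 2 ^ n) + 1) * (2 * C' ^ (2 ^ n))"
    proof (rule q_le_degree[OF M])
      fix t :: real assume "\<bar>t\<bar> \<le> M"
      then have "\<bar>poly f t\<bar> \<le> C'" using C[of t] C' by linarith
      then show "\<bar>poly (f ^ (2 ^ n)) t\<bar> \<le> C' ^ (2 ^ n)"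
        by (simp add: power_abs power_mono)
    qed (simp add: degree_power_le)
    then have "q f ^ (2 ^ n) \<le> ((real (degree f) * real (2 ^ n) + 1) * 2) * C' ^ (2 ^ n)"
      by (simp only: q_power_2_power mult.assoc of_nat_mult)
    then show ?thesis using \<open>C' > 0\<close> by (simp add: \<rho>_def power_divide divide_le_eq)
  qed
  have "norm (1 / \<rho>) < 1" using \<rho> by simp
  then have "(\<lambda>n. 2 * real (degree f) * (real n * (1 / \<rho>) ^ n) + 2 * (1 / \<rho>) ^ n) \<longlonglongrightarrow>
      2 * real (degree f) * 0 + 2 * 0"
    by (intro tendsto_intros powser_times_n_limit_0 LIMSEQ_power_zero)
  then have "eventually (\<lambda>n. 2 * real (degree f) * (real n * (1 / \<rho>) ^ n) + 2 * (1 / \<rho>) ^ n < 1) sequentially"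
    by (rule order_tendstoD) simp
  then obtain n where "\<And>m. m \<ge> n \<Longrightarrow> 2 * real (degree f) * (real m * (1 / \<rho>) ^ m) + 2 * (1 / \<rho>) ^ m < 1"
    by (auto simp: eventually_sequentially)
  from this[of "2 ^ n"] have "2 * real (degree f) * (real (2 ^ n) * (1 / \<rho>) ^ (2 ^ n)) + 2 * (1 / \<rho>) ^ (2 ^ n) < 1"
    by (simp add: less_imp_le)
  then have "((real (degree f) * real (2 ^ n) + 1) * 2) / \<rho> ^ (2 ^ n) < 1"
    by (simp add: power_divide add_divide_distrib algebra_simps)
  then have "(real (degree f) * real (2 ^ n) + 1) * 2 < \<rho> ^ (2 ^ n)"
    using \<rho> by (simp add: divide_less_eq)
  with bound[of n] show False by linarith
qed

text \<open>
  Points where every polynomial \<open>g\<close> satisfies \<open>\<bar>g t\<bar> \<le> q g\<close> determine the seminorm: if \<open>\<bar>f\<bar> < 1\<close>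
  there, then there are finitely many polynomials \<open>g\<close> with \<open>q g < 1\<close> such that one of them satisfies
  \<open>\<bar>g t\<bar> > 2\<close> at each point of \<open>[-M, M]\<close> with \<open>\<bar>f t\<bar> \<ge> 1\<close>. Hence \<open>f\<^sup>2 / (1 + \<Sum> g\<^bsup>2n\<^esup>)\<close> is bounded by \<open>1\<close> on \<open>[-M, M]\<close> for large \<open>n\<close>,
  while the denominator tends to \<open>1\<close> in the seminorm.
\<close>

lemma q_le_1_if_spectrum:
  assumes M: "q [:0, 1:] < M"
    and f: "\<And>t. \<lbrakk>\<bar>t\<bar> \<le> M; \<And>g. \<bar>poly g t\<bar> \<le> q g\<rbrakk> \<Longrightarrow> \<bar>poly f t\<bar> < 1"
  shows "q f \<le> 1"
proof -
  let ?I = "{-M..M}"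
  have "\<exists>g. q g < 1 \<and> 2 < \<bar>poly g t\<bar>" if t: "t \<in> ?I" "\<not> \<bar>poly f t\<bar> < 1" for t
  proof -
    have "\<exists>g. q g < \<bar>poly g t\<bar>" using f[of t] t by (force simp: not_le)
    then obtain g where g: "q g < \<bar>poly g t\<bar>" by blast
    obtain c where c: "q g < c" "c < \<bar>poly g t\<bar>" using dense[OF g] by blast
    have "c > 0" using c q_nonneg[of g] by linarith
    define h where "h = smult (1 / c) g"
    have h: "q h < 1" "1 < \<bar>poly h t\<bar>"
      using c \<open>c > 0\<close> by (simp_all add: h_def q_smult abs_mult)
    obtain n where n: "2 < \<bar>poly h t\<bar> ^ n" using real_arch_pow[OF h(2)] by blast
    then have "n \<noteq> 0" by (intro notI) simp
    then have "q h ^ n < 1" using h q_nonneg[of h] by (simp add: power_less_one_iff)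
    then have "q (h ^ n) < 1" using q_power[of h n] by linarith
    then show ?thesis using n by (intro exI[of _ "h ^ n"]) (simp add: power_abs)
  qed
  then have ex: "\<exists>g. q g < 1 \<and> (\<bar>poly f t\<bar> < 1 \<or> 2 < \<bar>poly g t\<bar>)" if "t \<in> ?I" for t
    using that q_zero by (metis zero_less_one)
  have cover: "?I \<subseteq> \<Union> ((\<lambda>g. {t. \<bar>poly f t\<bar> < 1} \<union> {t. 2 < \<bar>poly g t\<bar>}) ` ({g. q g < 1}))"
  proof
    fix t assume "t \<in> ?I"
    then obtain g where "q g < 1" "\<bar>poly f t\<bar> < 1 \<or> 2 < \<bar>poly g t\<bar>" using ex by blast
    then show "t \<in> \<Union> ((\<lambda>g. {t. \<bar>poly f t\<bar> < 1} \<union> {t. 2 < \<bar>poly g t\<bar>}) ` ({g. q g < 1}))"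
      by blast
  qed
  obtain G where G: "G \<subseteq> {g. q g < 1}" "finite G"
    "?I \<subseteq> \<Union> ((\<lambda>g. {t. \<bar>poly f t\<bar> < 1} \<union> {t. 2 < \<bar>poly g t\<bar>}) ` G)"
  proof (rule compactE_image[OF compact_Icc _ cover])
    show "open ({t. \<bar>poly f t\<bar> < 1} \<union> {t. 2 < \<bar>poly g t\<bar>})" for g
      by (intro open_Un open_Collect_less continuous_intros)
  qed
  have "compact ((\<lambda>t. (poly f t)\<^sup>2) ` ?I)"
    by (intro compact_continuous_image continuous_intros compact_Icc)
  then obtain K where K: "\<And>t. t \<in> ?I \<Longrightarrow> (poly f t)\<^sup>2 \<le> K"
    using compact_imp_bounded bounded_iff by (metis (no_types, lifting) imageI norm_power real_norm_def power2_abs)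
  have "(q f)\<^sup>2 \<le> e + (1 + e) * (1 + e)" if "e > 0" for e
  proof -
    have "(\<lambda>n. \<Sum>g\<in>G. (q g)\<^sup>2 ^ n) \<longlonglongrightarrow> (\<Sum>g\<in>G. 0)"
      using G(1) q_nonneg by (intro tendsto_sum LIMSEQ_power_zero) (auto simp: abs_square_less_1)
    then have "eventually (\<lambda>n. (\<Sum>g\<in>G. (q g)\<^sup>2 ^ n) < e) sequentially"
      using \<open>e > 0\<close> by (auto intro: order_tendstoD)
    moreover obtain n0 where "K < 4 ^ n0" using real_arch_pow[of 4 K] by auto
    then have "eventually (\<lambda>n. K < 4 ^ n) sequentially"
      unfolding eventually_sequentially
      by (intro exI[of _ n0] allI impI) (erule less_le_trans, simp)
    ultimately obtain n where n: "(\<Sum>g\<in>G. (q g)\<^sup>2 ^ n) < e" "K < 4 ^ n"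
      using eventually_conj eventually_sequentially by (metis (no_types, lifting) order_refl)
    define d where "d = 1 + (\<Sum>g\<in>G. g ^ (2 * n))"
    have d: "poly d t = 1 + (\<Sum>g\<in>G. (poly g t ^ 2) ^ n)" for t
      by (simp add: d_def poly_sum power_mult)
    have d1: "1 \<le> poly d t" for t
      unfolding d by (simp add: sum_nonneg)
    have fd: "(poly f t)\<^sup>2 \<le> poly d t" if "t \<in> ?I" for t
    proof (cases "\<bar>poly f t\<bar> < 1")
      case True
      then have "(poly f t)\<^sup>2 < 1" by (simp add: abs_square_less_1)
      then show ?thesis using d1[of t] by linarith
    next
      case False
      then obtain g where g: "g \<in> G" "2 < \<bar>poly g t\<bar>" using G(3) \<open>t \<in> ?I\<close> by fastforce
      have "4 \<le> (poly g t)\<^sup>2" using power_mono[of 2 "\<bar>poly g t\<bar>" 2] g(2) by simp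
      then have "4 ^ n \<le> (poly g t ^ 2) ^ n" by (intro power_mono) auto
      also have "\<dots> \<le> (\<Sum>g\<in>G. (poly g t ^ 2) ^ n)"
        using g(1) G(2) by (intro member_le_sum) auto
      finally show ?thesis using K[OF \<open>t \<in> ?I\<close>] n(2) unfolding d by linarith
    qed
    have "compact (poly d ` ?I)"
      by (intro compact_continuous_image continuous_intros compact_Icc)
    then obtain B where B: "\<And>t. t \<in> ?I \<Longrightarrow> \<bar>poly d t\<bar> \<le> B" "B > 0"
      using compact_imp_bounded bounded_pos by (metis (no_types, lifting) imageI real_norm_def)
    define \<delta> where "\<delta> = min e (e / B)"
    have "\<delta> > 0" using \<open>e > 0\<close> \<open>B > 0\<close> by (simp add: \<delta>_def)
    have "continuous_on ?I (\<lambda>t. (poly f t)\<^sup>2 / poly d t)"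
      using d1 by (intro continuous_intros) (metis not_one_le_zero)
    then obtain P where P: "\<And>t. t \<in> ?I \<Longrightarrow> \<bar>poly P t - (poly f t)\<^sup>2 / poly d t\<bar> < \<delta>"
      using Weierstrass_poly \<open>\<delta> > 0\<close> by meson
    have qP: "q P \<le> 1 + e"
    proof (rule q_le_sup[OF M])
      fix t :: real assume "\<bar>t\<bar> \<le> M"
      then have t: "t \<in> ?I" by (auto simp: abs_le_iff)
      have "(poly f t)\<^sup>2 / poly d t \<le> 1" "0 \<le> (poly f t)\<^sup>2 / poly d t"
        using fd[OF t] d1[of t] by (simp_all add: divide_le_eq)
      moreover have "\<delta> \<le> e" by (simp add: \<delta>_def)
      ultimately show "\<bar>poly P t\<bar> \<le> 1 + e" using P[OF t] by (auto simp: abs_if split: if_splits)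
    qed
    have "q (f\<^sup>2 - P * d) \<le> e"
    proof (rule q_le_sup[OF M])
      fix t :: real assume "\<bar>t\<bar> \<le> M"
      then have t: "t \<in> ?I" by (auto simp: abs_le_iff)
      have "poly (f\<^sup>2 - P * d) t = - ((poly P t - (poly f t)\<^sup>2 / poly d t) * poly d t)"
        using d1[of t] by (simp add: field_simps)
      then have "\<bar>poly (f\<^sup>2 - P * d) t\<bar> = \<bar>poly P t - (poly f t)\<^sup>2 / poly d t\<bar> * \<bar>poly d t\<bar>"
        by (simp only: abs_minus_cancel abs_mult)
      also have "\<dots> \<le> \<delta> * B"
        using P[OF t] B(1)[OF t] \<open>\<delta> > 0\<close> by (intro mult_mono) auto
      also have "\<dots> \<le> e / B * B" using \<open>B > 0\<close> by (intro mult_right_mono) (auto simp: \<delta>_def)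
      finally show "\<bar>poly (f\<^sup>2 - P * d) t\<bar> \<le> e" using \<open>B > 0\<close> by simp
    qed
    moreover have "q d \<le> 1 + e"
    proof -
      have "q d \<le> 1 + (\<Sum>g\<in>G. q (g ^ (2 * n)))"
        unfolding d_def using q_add q_one q_sum[OF G(2)] by (meson add_mono order_trans)
      also have "(\<Sum>g\<in>G. q (g ^ (2 * n))) \<le> (\<Sum>g\<in>G. (q g)\<^sup>2 ^ n)"
        by (intro sum_mono) (metis q_power power_mult)
      finally show ?thesis using n(1) by linarith
    qed
    ultimately have "q (P * d) \<le> (1 + e) * (1 + e)" "q (f\<^sup>2 - P * d) \<le> e"
      using qP q_nonneg \<open>e > 0\<close> by (auto intro!: order_trans[OF q_mult] mult_mono)
    then show ?thesis using q_add[of "f\<^sup>2 - P * d" "P * d"] by (simp add: q_power2)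
  qed
  then have "(q f)\<^sup>2 \<le> 1 + e" if "e > 0" for e
  proof -
    let ?e = "min 1 (e / 4)"
    have "(q f)\<^sup>2 \<le> ?e + (1 + ?e) * (1 + ?e)" using \<open>\<And>e. e > 0 \<Longrightarrow> _\<close> that by simp
    moreover have "?e * ?e \<le> ?e * 1" using that by (intro mult_left_mono) auto
    ultimately show ?thesis by (simp add: algebra_simps) linarith
  qed
  then have "(q f)\<^sup>2 \<le> 1" by (rule field_le_epsilon)
  then show ?thesis by (simp add: abs_square_le_1 q_nonneg)
qed

theorem spectrum_exists:
  "\<exists>\<sigma>. compact \<sigma> \<and> (\<forall>f C. 0 \<le> C \<longrightarrow> (q f \<le> C \<longleftrightarrow> (\<forall>t\<in>\<sigma>. \<bar>poly f t\<bar> \<le> C)))"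
proof -
  define M where "M = q [:0, 1:] + 1"
  have M: "q [:0, 1:] < M" by (simp add: M_def)
  define \<sigma> where "\<sigma> = {-M..M} \<inter> (\<Inter>g. {t. \<bar>poly g t\<bar> \<le> q g})"
  have "compact \<sigma>"
    unfolding \<sigma>_def
    by (intro compact_Int_closed compact_Icc closed_INT ballI closed_Collect_le continuous_intros)
  moreover have "q f \<le> C" if C: "0 \<le> C" and f: "\<forall>t\<in>\<sigma>. \<bar>poly f t\<bar> \<le> C" for f C
  proof (rule field_le_epsilon)
    fix e :: real assume "e > 0"
    then have "C + e > 0" using C by linarith
    have "q (smult (1 / (C + e)) f) \<le> 1"
    proof (rule q_le_1_if_spectrum[OF M])
      fix t assume "\<bar>t\<bar> \<le> M" "\<And>g. \<bar>poly g t\<bar> \<le> q g"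
      then have "t \<in> \<sigma>" by (auto simp: \<sigma>_def abs_le_iff)
      then have "\<bar>poly f t\<bar> < C + e" using f \<open>e > 0\<close> by fastforce
      then show "\<bar>poly (smult (1 / (C + e)) f) t\<bar> < 1" using \<open>C + e > 0\<close> by (simp add: abs_mult)
    qed
    then show "q f \<le> C + e" using \<open>C + e > 0\<close> by (simp add: q_smult divide_le_eq)
  qed
  moreover have "\<bar>poly f t\<bar> \<le> C" if "q f \<le> C" "t \<in> \<sigma>" for f C t
  proof -
    have "\<bar>poly f t\<bar> \<le> q f" using \<open>t \<in> \<sigma>\<close> unfolding \<sigma>_def by blast
    then show ?thesis using \<open>q f \<le> C\<close> by linarith
  qed
  ultimately show ?thesis by (intro exI[of _ \<sigma>]) blast
qed

end

section \<open>Polynomials of a self-adjoint operator\<close>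

text \<open>Horner evaluation of a real polynomial at an operator of a complex vector space.\<close>

definition poly_op :: "(complex \<Rightarrow> 'e \<Rightarrow> 'e) \<Rightarrow> ('e \<Rightarrow> 'e) \<Rightarrow> real poly \<Rightarrow> 'e \<Rightarrow> 'e::ab_group_add" where
  "poly_op scl T f x = fold_coeffs (\<lambda>a y. scl (complex_of_real a) x + T y) f 0"

locale linear_operator = vector_space scl
  for scl :: "complex \<Rightarrow> 'e::ab_group_add \<Rightarrow> 'e" +
  fixes T :: "'e \<Rightarrow> 'e"
  assumes T_add: "T (x + y) = T x + T y"
    and T_scale: "T (scl c x) = scl c (T x)"
begin

lemma T_zero: "T 0 = 0"
  using T_add[of 0 0] by simp

lemma poly_op_0 [simp]: "poly_op scl T 0 x = 0"
  by (simp add: poly_op_def)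

lemma poly_op_pCons [simp]:
  "poly_op scl T (pCons a f) x = scl (complex_of_real a) x + T (poly_op scl T f x)"
proof (cases "f = 0 \<and> a = 0")
  case False
  then show ?thesis by (auto simp: poly_op_def)
qed (simp add: T_zero)

lemma poly_op_add: "poly_op scl T (f + g) x = poly_op scl T f x + poly_op scl T g x"
  by (induction f g rule: poly_induct2) (simp_all add: T_add scale_left_distrib)

lemma poly_op_smult: "poly_op scl T (smult c f) x = scl (complex_of_real c) (poly_op scl T f x)"
  by (induction f) (simp_all add: T_scale scale_right_distrib)

lemma poly_op_minus: "poly_op scl T (- f) x = - poly_op scl T f x"
  using poly_op_smult[of "-1" f x] by simp

lemma poly_op_diff: "poly_op scl T (f - g) x = poly_op scl T f x - poly_op scl T g x"
  using poly_op_add[of f "- g" x] by (simp add: poly_op_minus)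

lemma poly_op_1 [simp]: "poly_op scl T 1 x = x"
  by (simp add: one_pCons T_zero)

lemma poly_op_arg_add: "poly_op scl T f (x + y) = poly_op scl T f x + poly_op scl T f y"
  by (induction f) (simp_all add: T_add scale_right_distrib)

lemma poly_op_arg_scale: "poly_op scl T f (scl c x) = scl c (poly_op scl T f x)"
  by (induction f) (simp_all add: T_scale scale_right_distrib scale_left_commute)

lemma poly_op_mult: "poly_op scl T (f * g) x = poly_op scl T f (poly_op scl T g x)"
  by (induction f) (simp_all add: poly_op_add poly_op_smult)

lemma poly_op_commute: "poly_op scl T f (T x) = T (poly_op scl T f x)"
  by (induction f) (simp_all add: T_zero T_add T_scale)

end

text \<open>
  A complex vector space with a sesquilinear form that takes values in a *-algebra, and a
  C*-seminorm for which the Cauchy-Schwarz inequality holds. For Hilbert modules this inequality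
  is a theorem, but its proof uses the results of this section for the algebra itself, with the
  form \<open>\<langle>x, y\<rangle> = x\<^sup>*y\<close>.
\<close>

locale cauchy_schwarz_module =
  complex_star_algebra scaleA star + E: vector_space scaleE
  for scaleA :: "complex \<Rightarrow> 'a::ring \<Rightarrow> 'a"
    and star :: "'a \<Rightarrow> 'a"
    and scaleE :: "complex \<Rightarrow> 'e::ab_group_add \<Rightarrow> 'e" +
  fixes ip :: "'e \<Rightarrow> 'e \<Rightarrow> 'a" and p :: "'a \<Rightarrow> real"
  assumes seminorm: "cstar_seminorm scaleA star p"
    and ip_add: "ip x (y + z) = ip x y + ip x z"
    and ip_scale: "ip x (scaleE c y) = scaleA c (ip x y)"
    and ip_sym: "ip x y = star (ip y x)"
    and cauchy_schwarz: "(p (ip x y))\<^sup>2 \<le> p (ip x x) * p (ip y y)"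
begin

abbreviation nrm :: "'e \<Rightarrow> real" where "nrm \<equiv> module_seminorm ip p"

abbreviation opnrm :: "('e \<Rightarrow> 'e) \<Rightarrow> real" where "opnrm \<equiv> operator_seminorm ip p"

lemma p_nonneg: "0 \<le> p a"
  and p_add: "p (a + b) \<le> p a + p b"
  and p_scale: "p (scaleA c a) = cmod c * p a"
  and p_mult: "p (a * b) \<le> p a * p b"
  and p_star: "p (star a) = p a"
  and p_star_mult: "p (star a * a) = (p a)\<^sup>2"
  using seminorm unfolding cstar_seminorm_def by auto

lemma ip_add_left: "ip (x + y) z = ip x z + ip y z"
  by (subst (1 2 3) ip_sym) (simp add: ip_add star_add)

lemma ip_scale_left: "ip (scaleE c x) z = scaleA (cnj c) (ip x z)"
  by (subst (1 2) ip_sym) (simp add: ip_scale star_scale)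

lemma nrm_nonneg: "0 \<le> nrm x"
  by (simp add: module_seminorm_def p_nonneg)

lemma nrm_square: "(nrm x)\<^sup>2 = p (ip x x)"
  by (simp add: module_seminorm_def p_nonneg)

lemma p_ip_le: "p (ip x y) \<le> nrm x * nrm y"
proof (rule power2_le_imp_le)
  show "(p (ip x y))\<^sup>2 \<le> (nrm x * nrm y)\<^sup>2"
    using cauchy_schwarz by (simp add: power_mult_distrib nrm_square)
qed (simp add: nrm_nonneg)

lemma nrm_scale: "nrm (scaleE c x) = cmod c * nrm x"
proof -
  have "p (ip (scaleE c x) (scaleE c x)) = (cmod c)\<^sup>2 * p (ip x x)"
    by (simp add: ip_scale ip_scale_left p_scale power2_eq_square norm_mult)
  then show ?thesis by (simp add: module_seminorm_def real_sqrt_mult)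
qed

lemma nrm_add: "nrm (x + y) \<le> nrm x + nrm y"
proof (rule power2_le_imp_le)
  have "(nrm (x + y))\<^sup>2 = p ((ip x x + ip x y) + (ip y x + ip y y))"
    by (simp add: nrm_square ip_add ip_add_left algebra_simps)
  also have "\<dots> \<le> (p (ip x x) + p (ip x y)) + (p (ip y x) + p (ip y y))"
    by (meson add_mono order_trans p_add)
  also have "\<dots> \<le> ((nrm x)\<^sup>2 + nrm x * nrm y) + (nrm y * nrm x + (nrm y)\<^sup>2)"
    by (intro add_mono p_ip_le) (simp_all add: nrm_square)
  finally show "(nrm (x + y))\<^sup>2 \<le> (nrm x + nrm y)\<^sup>2"
    by (simp add: power2_eq_square algebra_simps)
qed (simp add: nrm_nonneg add_nonneg_nonneg)

lemma nrm_zero: "nrm 0 = 0"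
  using nrm_scale[of 0 0] by simp

lemma nrm_minus: "nrm (- x) = nrm x"
  using nrm_scale[of "-1" x] by simp

lemma nrm_diff: "nrm (x - y) \<le> nrm x + nrm y"
  using nrm_add[of x "- y"] by (simp add: nrm_minus)

lemma opnrm_le:
  assumes "0 \<le> M" "\<And>x. nrm (S x) \<le> M * nrm x"
  shows "opnrm S \<le> M"
  unfolding operator_seminorm_def
proof (rule cSUP_least)
  show "{x. nrm x \<le> 1} \<noteq> {}" using nrm_zero by (metis empty_iff mem_Collect_eq zero_le_one)
  fix x assume "x \<in> {x. nrm x \<le> 1}"
  then have "M * nrm x \<le> M * 1" using assms(1) by (intro mult_left_mono) auto
  then show "nrm (S x) \<le> M" using assms(2)[of x] by simp
qed

lemma nrm_le_opnrm:
  assumes S: "\<And>c x. S (scaleE c x) = scaleE c (S x)" and M: "\<And>x. nrm (S x) \<le> M * nrm x"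
  shows "nrm (S x) \<le> opnrm S * nrm x"
proof (cases "nrm x = 0")
  case True
  then show ?thesis using M[of x] by simp
next
  case False
  then have pos: "0 < nrm x" using nrm_nonneg[of x] by simp
  let ?c = "complex_of_real (1 / nrm x)"
  have c: "cmod ?c = 1 / nrm x" using pos by (simp add: norm_divide)
  have le: "nrm (S y) \<le> \<bar>M\<bar>" if "nrm y \<le> 1" for y
  proof -
    have "nrm (S y) \<le> M * nrm y" by (rule M)
    also have "\<dots> \<le> \<bar>M\<bar> * nrm y" using nrm_nonneg by (intro mult_right_mono) auto
    also have "\<dots> \<le> \<bar>M\<bar> * 1" using that by (intro mult_left_mono) auto
    finally show ?thesis by simp
  qed
  have "nrm (S (scaleE ?c x)) \<le> opnrm S"
    unfolding operator_seminorm_def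
  proof (rule cSUP_upper)
    show "scaleE ?c x \<in> {x. nrm x \<le> 1}" using pos by (simp only: mem_Collect_eq nrm_scale c) simp
    show "bdd_above ((\<lambda>x. nrm (S x)) ` {x. nrm x \<le> 1})" using le by (intro bdd_aboveI2) auto
  qed
  then have "nrm (S x) / nrm x \<le> opnrm S" by (simp only: S nrm_scale c) simp
  then show ?thesis using pos by (simp add: divide_le_eq)
qed

lemma opnrm_nonneg:
  assumes "\<And>c x. S (scaleE c x) = scaleE c (S x)" and "\<And>x. nrm (S x) \<le> M * nrm x"
  shows "0 \<le> opnrm S"
proof -
  have "S 0 = 0" using assms(1)[of 0 0] by simp
  then have "nrm (S 0) = 0" by (simp add: nrm_zero)
  moreover have bdd: "bdd_above ((\<lambda>x. nrm (S x)) ` {x. nrm x \<le> 1})"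
  proof (rule bdd_aboveI2)
    fix x assume "x \<in> {x. nrm x \<le> 1}"
    then have "\<bar>M\<bar> * nrm x \<le> \<bar>M\<bar> * 1" by (intro mult_left_mono) auto
    moreover have "M * nrm x \<le> \<bar>M\<bar> * nrm x" using nrm_nonneg by (intro mult_right_mono) auto
    ultimately show "nrm (S x) \<le> \<bar>M\<bar>" using assms(2)[of x] by linarith
  qed
  moreover have "nrm (S 0) \<le> opnrm S"
    unfolding operator_seminorm_def using bdd by (intro cSUP_upper) (auto simp: nrm_zero)
  ultimately show ?thesis by simp
qed

text \<open>
  The spectral theorem that is used below: for one seminorm, the norms of the polynomials of a
  self-adjoint operator are their suprema over a compact set of real numbers.
\<close>

theorem spectrum_selfadjoint:
  assumes lin: "\<And>x y. T (x + y) = T x + T y" "\<And>c x. T (scaleE c x) = scaleE c (T x)"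
    and sa: "\<And>x y. ip (T x) y = ip x (T y)"
    and bd: "\<And>x. nrm (T x) \<le> M * nrm x"
  shows "\<exists>\<sigma>. compact \<sigma> \<and> (\<forall>f C. 0 \<le> C \<longrightarrow>
    ((\<forall>x. nrm (poly_op scaleE T f x) \<le> C * nrm x) \<longleftrightarrow> (\<forall>t\<in>\<sigma>. \<bar>poly f t\<bar> \<le> C)))"
proof -
  interpret T: linear_operator scaleE T
    using lin by unfold_locales auto
  let ?P = "poly_op scaleE T"
  define q where "q f = opnrm (?P f)" for f
  have bounded: "\<exists>B. \<forall>x. nrm (?P f x) \<le> B * nrm x" for f
  proof (induction f)
    case 0
    show ?case by (intro exI[of _ 0]) (simp add: nrm_zero)
  next
    case (pCons a f)
    then obtain B where B: "\<And>x. nrm (?P f x) \<le> B * nrm x" by blast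
    have "nrm (?P (pCons a f) x) \<le> (\<bar>a\<bar> + \<bar>M\<bar> * B) * nrm x" for x
    proof -
      have "nrm (T (?P f x)) \<le> \<bar>M\<bar> * nrm (?P f x)"
        using bd[of "?P f x"] mult_right_mono[OF abs_ge_self[of M] nrm_nonneg[of "?P f x"]] by linarith
      also have "\<dots> \<le> \<bar>M\<bar> * (B * nrm x)" using B by (intro mult_left_mono) auto
      finally show ?thesis
        using nrm_add[of "scaleE (complex_of_real a) x" "T (?P f x)"]
        by (simp add: nrm_scale algebra_simps)
    qed
    then show ?case by blast
  qed
  have le_q: "nrm (?P f x) \<le> q f * nrm x" for f x
  proof -
    obtain B where "\<And>x. nrm (?P f x) \<le> B * nrm x" using bounded by blast
    then show ?thesis unfolding q_def by (intro nrm_le_opnrm T.poly_op_arg_scale)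
  qed
  have q_nonneg: "0 \<le> q f" for f
  proof -
    obtain B where "\<And>x. nrm (?P f x) \<le> B * nrm x" using bounded by blast
    then show ?thesis unfolding q_def by (intro opnrm_nonneg T.poly_op_arg_scale)
  qed
  have q_le: "q f \<le> C" if "0 \<le> C" "\<And>x. nrm (?P f x) \<le> C * nrm x" for f C
    unfolding q_def using that by (rule opnrm_le)
  have P_sa: "ip (?P f x) y = ip x (?P f y)" for f x y
    by (induction f arbitrary: x y)
       (simp_all add: ip_add ip_add_left ip_scale ip_scale_left sa T.poly_op_commute[symmetric]
          ip_scale[of _ 0 0, simplified] ip_scale_left[of 0 0, simplified])
  interpret poly_cstar_seminorm q
  proof
    fix f g :: "real poly" and c :: real
    show "q (f + g) \<le> q f + q g"
    proof (rule q_le)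
      fix x
      show "nrm (?P (f + g) x) \<le> (q f + q g) * nrm x"
        using nrm_add[of "?P f x" "?P g x"] le_q[of f x] le_q[of g x]
        by (simp add: T.poly_op_add distrib_right)
    qed (simp add: q_nonneg add_nonneg_nonneg)
    have smult_le: "q (smult c f) \<le> \<bar>c\<bar> * q f" for c f
      using le_q[of f] q_nonneg[of f]
      by (intro q_le) (auto simp: T.poly_op_smult nrm_scale mult.assoc intro: mult_left_mono)
    show "q (smult c f) = \<bar>c\<bar> * q f"
    proof (cases "c = 0")
      case True
      then show ?thesis using smult_le[of 0 f] q_nonneg[of 0] by simp
    next
      case False
      have "q f \<le> \<bar>1 / c\<bar> * q (smult c f)" using smult_le[of "1 / c" "smult c f"] False by simp
      then have "\<bar>c\<bar> * q f \<le> q (smult c f)" using False by (simp add: field_simps)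
      then show ?thesis using smult_le[of c f] by simp
    qed
    show "q (f * g) \<le> q f * q g"
    proof (rule q_le)
      fix x
      have "nrm (?P (f * g) x) \<le> q f * nrm (?P g x)" by (simp add: T.poly_op_mult le_q)
      also have "\<dots> \<le> q f * (q g * nrm x)" by (intro mult_left_mono le_q q_nonneg)
      finally show "nrm (?P (f * g) x) \<le> q f * q g * nrm x" by (simp add: mult.assoc)
    qed (simp add: q_nonneg)
    show "q 1 \<le> 1" by (rule q_le) simp_all
    show "(q f)\<^sup>2 \<le> q (f\<^sup>2 + g\<^sup>2)"
    proof -
      \<comment> \<open>The operators \<open>U = f(T) + i g(T)\<close> and \<open>V = f(T) - i g(T)\<close> are adjoint to each other,
        and \<open>U V = V U = f(T)\<^sup>2 + g(T)\<^sup>2\<close>.\<close>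
      let ?N = "q (f\<^sup>2 + g\<^sup>2)"
      have key: "nrm (?P f x + scaleE c (?P g x)) \<le> sqrt ?N * nrm x" if c: "c = \<i> \<or> c = - \<i>" for c x
      proof (rule power2_le_imp_le)
        let ?U = "?P f x + scaleE c (?P g x)"
        have cc: "c * c = - 1" "cnj c = - c" using c by auto
        have "ip ?U ?U = ip x (?P f ?U - scaleE c (?P g ?U))"
          by (simp add: ip_add_left ip_scale_left P_sa cc ip_add[of x "?P f ?U" "- scaleE c (?P g ?U)", simplified]
             ip_scale[of x "-c", simplified] scale_minus_left)
        also have "?P f ?U - scaleE c (?P g ?U) = ?P (f\<^sup>2 + g\<^sup>2) x"
          by (simp add: T.poly_op_arg_add T.poly_op_arg_scale T.poly_op_add T.poly_op_mult cc
              power2_eq_square E.scale_right_distrib mult.commute[of f g] flip: T.poly_op_mult)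
        finally have "(nrm ?U)\<^sup>2 \<le> nrm x * nrm (?P (f\<^sup>2 + g\<^sup>2) x)"
          using p_ip_le by (simp add: nrm_square)
        also have "\<dots> \<le> nrm x * (?N * nrm x)" by (intro mult_left_mono le_q nrm_nonneg)
        finally show "(nrm ?U)\<^sup>2 \<le> (sqrt ?N * nrm x)\<^sup>2"
          by (simp add: power_mult_distrib q_nonneg power2_eq_square[of "nrm x"] mult_ac)
      qed (simp add: nrm_nonneg q_nonneg)
      have "q f \<le> sqrt ?N"
      proof (rule q_le)
        fix x
        have "?P f x = scaleE (1 / 2) ((?P f x + scaleE \<i> (?P g x)) + (?P f x + scaleE (- \<i>) (?P g x)))"
          by (simp add: E.scale_right_distrib flip: E.scale_left_distrib)
        then have "nrm (?P f x) = 1 / 2 * nrm ((?P f x + scaleE \<i> (?P g x)) + (?P f x + scaleE (- \<i>) (?P g x)))"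
          by (metis nrm_scale norm_divide norm_numeral norm_one)
        also have "\<dots> \<le> 1 / 2 * (sqrt ?N * nrm x + sqrt ?N * nrm x)"
          by (intro mult_left_mono order_trans[OF nrm_add] add_mono key) auto
        finally show "nrm (?P f x) \<le> sqrt ?N * nrm x" by (simp add: mult.commute)
      qed (simp add: q_nonneg)
      then have "(q f)\<^sup>2 \<le> (sqrt ?N)\<^sup>2" using q_nonneg by (intro power_mono) auto
      then show ?thesis using q_nonneg by simp
    qed
  qed
  have iff: "q f \<le> C \<longleftrightarrow> (\<forall>x. nrm (?P f x) \<le> C * nrm x)" if "0 \<le> C" for f C
    using le_q[of f] q_le[OF that, of f] nrm_nonneg
    by (meson mult_right_mono order_trans)
  show ?thesis using spectrum_exists iff by metis
qed

end

section \<open>Positivity in an algebra with a C*-seminorm\<close>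

text \<open>The algebra acts on itself by left multiplication; the form \<open>x\<^sup>*y\<close> makes it a module over
  itself, so that the spectral theorem applies to its self-adjoint elements.\<close>

locale cstar_seminormed_algebra = complex_star_algebra scl star
  for scl :: "complex \<Rightarrow> 'a::ring \<Rightarrow> 'a" and star :: "'a \<Rightarrow> 'a" +
  fixes p :: "'a \<Rightarrow> real"
  assumes cstar_seminorm: "cstar_seminorm scl star p"

sublocale cstar_seminormed_algebra \<subseteq> self: cauchy_schwarz_module scl star scl "\<lambda>x y. star x * y" p
proof
  fix x y z c
  show "star x * (y + z) = star x * y + star x * z" by (rule distrib_left)
  show "star x * scl c y = scl c (star x * y)" by (rule scale_mult_right[symmetric])
  show "star x * y = star (star y * x)" by (simp add: star_mult star_star)
  have "p (star x * y) \<le> p x * p y" "0 \<le> p (star x * y)"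
    using cstar_seminorm unfolding cstar_seminorm_def by metis+
  then have "(p (star x * y))\<^sup>2 \<le> (p x * p y)\<^sup>2" by (intro power_mono)
  then show "(p (star x * y))\<^sup>2 \<le> p (star x * x) * p (star y * y)"
    using cstar_seminorm unfolding cstar_seminorm_def by (simp add: power_mult_distrib)
qed (rule cstar_seminorm)

context cstar_seminormed_algebra
begin

abbreviation poly_left :: "'a \<Rightarrow> real poly \<Rightarrow> 'a \<Rightarrow> 'a" where
  "poly_left h \<equiv> poly_op scl (\<lambda>x. h * x)"

lemma nrm_eq: "self.nrm x = p x"
  by (simp add: module_seminorm_def self.p_star_mult self.p_nonneg)

lemma linear_operator_left: "linear_operator scl (\<lambda>x. h * x)"
  by unfold_locales (simp_all add: distrib_left scale_mult_right)

lemma star_minus: "star (- a) = - star a"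
  using star_scale[of "-1" a] by simp

lemma spectrum_element:
  assumes "star h = h"
  obtains \<sigma> where "compact \<sigma>"
    "\<And>f C. 0 \<le> C \<Longrightarrow> (\<forall>x. p (poly_left h f x) \<le> C * p x) \<longleftrightarrow> (\<forall>t\<in>\<sigma>. \<bar>poly f t\<bar> \<le> C)"
proof -
  have "star (h * x) * y = star x * (h * y)" for x y
    using assms by (simp add: star_mult mult.assoc)
  moreover have "self.nrm (h * x) \<le> p h * self.nrm x" for x
    by (simp add: nrm_eq self.p_mult)
  ultimately show ?thesis
    using self.spectrum_selfadjoint[of "\<lambda>x. h * x" "p h"] that
    by (auto simp: nrm_eq distrib_left scale_mult_right)
qed

text \<open>
  \<open>spectrum_ge h \<alpha>\<close> says that the spectrum of \<open>h\<close> lies in \<open>[\<alpha>, \<infinity>)\<close>. It is expressed by norms,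
  \<open>\<parallel>r + \<alpha> - h\<parallel> \<le> r\<close> for large \<open>r\<close>, which makes it evidently additive.
\<close>

definition spectrum_ge :: "'a \<Rightarrow> real \<Rightarrow> bool" where
  "spectrum_ge h \<alpha> \<longleftrightarrow>
     (\<exists>r0. \<forall>r\<ge>r0. \<forall>x. p (scl (complex_of_real (r + \<alpha>)) x - h * x) \<le> r * p x)"

lemma spectrum_ge_add:
  assumes "spectrum_ge h \<alpha>" "spectrum_ge k \<beta>"
  shows "spectrum_ge (h + k) (\<alpha> + \<beta>)"
proof -
  obtain r1 where r1: "\<And>r x. r \<ge> r1 \<Longrightarrow> p (scl (complex_of_real (r + \<alpha>)) x - h * x) \<le> r * p x"
    using assms(1) unfolding spectrum_ge_def by blast
  obtain r2 where r2: "\<And>r x. r \<ge> r2 \<Longrightarrow> p (scl (complex_of_real (r + \<beta>)) x - k * x) \<le> r * p x"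
    using assms(2) unfolding spectrum_ge_def by blast
  have "p (scl (complex_of_real (r + (\<alpha> + \<beta>))) x - (h + k) * x) \<le> r * p x" if "r \<ge> r1 + r2" for r x
  proof -
    have "scl (complex_of_real (r + (\<alpha> + \<beta>))) x - (h + k) * x =
        (scl (complex_of_real (r1 + \<alpha>)) x - h * x) + (scl (complex_of_real ((r - r1) + \<beta>)) x - k * x)"
      by (simp add: distrib_right scale_left_distrib scale_left_diff_distrib)
    also have "p \<dots> \<le> r1 * p x + (r - r1) * p x"
      using r1[of r1 x] r2[of "r - r1" x] that by (intro order_trans[OF self.p_add] add_mono) auto
    finally show ?thesis by (simp add: algebra_simps)
  qed
  then show ?thesis unfolding spectrum_ge_def by blast
qed

lemma spectrum_ge_half:
  assumes "spectrum_ge (h + h) (\<alpha> + \<alpha>)"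
  shows "spectrum_ge h \<alpha>"
proof -
  obtain r0 where r0: "\<And>r x. r \<ge> r0 \<Longrightarrow>
      p (scl (complex_of_real (r + (\<alpha> + \<alpha>))) x - (h + h) * x) \<le> r * p x"
    using assms unfolding spectrum_ge_def by blast
  have "p (scl (complex_of_real (r + \<alpha>)) x - h * x) \<le> r * p x" if "r \<ge> r0 / 2" for r x
  proof -
    have "scl 2 u = u + u" for u
      using scale_left_distrib[of 1 1 u] by simp
    then have "scl 2 (scl (complex_of_real (r + \<alpha>)) x - h * x)
        = (scl (complex_of_real (r + \<alpha>)) x + scl (complex_of_real (r + \<alpha>)) x) - (h + h) * x"
      by (simp add: distrib_right)
    also have "\<dots> = scl (complex_of_real ((r + r) + (\<alpha> + \<alpha>))) x - (h + h) * x"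
      by (simp only: scale_left_distrib of_real_add add_ac)
    finally have "2 * p (scl (complex_of_real (r + \<alpha>)) x - h * x) \<le> (r + r) * p x"
      using r0[of "r + r" x] that self.p_scale[of 2 "scl (complex_of_real (r + \<alpha>)) x - h * x"] by simp
    then show ?thesis by (simp add: algebra_simps)
  qed
  then show ?thesis unfolding spectrum_ge_def by blast
qed

lemma spectrum_ge_iff:
  assumes "compact \<sigma>"
    and \<sigma>: "\<And>f C. 0 \<le> C \<Longrightarrow> (\<forall>x. p (poly_left h f x) \<le> C * p x) \<longleftrightarrow> (\<forall>t\<in>\<sigma>. \<bar>poly f t\<bar> \<le> C)"
  shows "spectrum_ge h \<alpha> \<longleftrightarrow> (\<forall>t\<in>\<sigma>. \<alpha> \<le> t)"
proof -
  interpret h: linear_operator scl "\<lambda>x. h * x" by (rule linear_operator_left)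
  have eq: "poly_left h [:r + \<alpha>, -1:] x = scl (complex_of_real (r + \<alpha>)) x - h * x" for r x
    by simp
  show ?thesis
  proof
    assume "spectrum_ge h \<alpha>"
    then obtain r0 where r0: "\<And>r x. r \<ge> r0 \<Longrightarrow> p (scl (complex_of_real (r + \<alpha>)) x - h * x) \<le> r * p x"
      unfolding spectrum_ge_def by blast
    have "\<forall>x. p (poly_left h [:max r0 0 + \<alpha>, -1:] x) \<le> max r0 0 * p x"
      unfolding eq using r0 by (simp only: max.cobounded1 simp_thms)
    then have "\<forall>t\<in>\<sigma>. \<bar>poly [:max r0 0 + \<alpha>, -1:] t\<bar> \<le> max r0 0"
      using \<sigma>[of "max r0 0"] by (simp only: max.cobounded2)
    then show "\<forall>t\<in>\<sigma>. \<alpha> \<le> t" by fastforce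
  next
    assume le: "\<forall>t\<in>\<sigma>. \<alpha> \<le> t"
    obtain B where B: "\<And>t. t \<in> \<sigma> \<Longrightarrow> \<bar>t\<bar> \<le> B" "B > 0"
      using compact_imp_bounded[OF \<open>compact \<sigma>\<close>] by (auto simp: bounded_pos)
    have "p (scl (complex_of_real (r + \<alpha>)) x - h * x) \<le> r * p x" if "r \<ge> B + \<bar>\<alpha>\<bar>" for r x
    proof -
      have "\<forall>t\<in>\<sigma>. \<bar>poly [:r + \<alpha>, -1:] t\<bar> \<le> r" using B le that by fastforce
      then show ?thesis using \<sigma>[of r "[:r + \<alpha>, -1:]"] B(2) that unfolding eq by simp
    qed
    then show "spectrum_ge h \<alpha>" unfolding spectrum_ge_def by blast
  qed
qed

lemma spectrum_ge_square:
  assumes u: "star u = u"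
  shows "spectrum_ge (u * u) 0"
proof -
  interpret u: linear_operator scl "\<lambda>x. u * x" by (rule linear_operator_left)
  obtain \<sigma> where \<sigma>: "compact \<sigma>"
    "\<And>f C. 0 \<le> C \<Longrightarrow> (\<forall>x. p (poly_left u f x) \<le> C * p x) \<longleftrightarrow> (\<forall>t\<in>\<sigma>. \<bar>poly f t\<bar> \<le> C)"
    using spectrum_element[OF u] by blast
  obtain B where B: "\<And>t. t \<in> \<sigma> \<Longrightarrow> \<bar>t\<bar> \<le> B" "B > 0"
    using compact_imp_bounded[OF \<sigma>(1)] by (auto simp: bounded_pos)
  have "p (scl (complex_of_real (r + 0)) x - (u * u) * x) \<le> r * p x" if "r \<ge> B\<^sup>2" for r x
  proof -
    have "poly_left u [:r, 0, -1:] x = scl (complex_of_real (r + 0)) x - (u * u) * x"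
      by (simp add: mult.assoc)
    moreover have "\<forall>t\<in>\<sigma>. \<bar>poly [:r, 0, -1:] t\<bar> \<le> r"
    proof
      fix t assume "t \<in> \<sigma>"
      then have "\<bar>t\<bar>\<^sup>2 \<le> B\<^sup>2" using B by (intro power_mono) auto
      then have "0 \<le> t * t" "t * t \<le> r" using that by (simp_all add: power2_eq_square)
      then show "\<bar>poly [:r, 0, -1:] t\<bar> \<le> r" by simp
    qed
    moreover have "0 \<le> r" using that zero_le_power2[of B] by linarith
    ultimately show ?thesis using \<sigma>(2)[of r "[:r, 0, -1:]"] by metis
  qed
  then show ?thesis unfolding spectrum_ge_def by blast
qed

lemma poly_left_pcompose:
  assumes "\<And>x. k * x = poly_left h g x"
  shows "poly_left k f x = poly_left h (pcompose f g) x"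
proof -
  interpret h: linear_operator scl "\<lambda>x. h * x" by (rule linear_operator_left)
  interpret k: linear_operator scl "\<lambda>x. k * x" by (rule linear_operator_left)
  show ?thesis
  proof (induction f)
    case (pCons a f)
    have "k * poly_left k f x = poly_left h g (poly_left h (pcompose f g) x)"
      using assms[of "poly_left k f x"] by (simp only: pCons.IH)
    then have "poly_left k (pCons a f) x = scl (complex_of_real a) x + poly_left h g (poly_left h (pcompose f g) x)"
      by (simp only: k.poly_op_pCons)
    then show ?case by (simp add: pcompose_pCons h.poly_op_add h.poly_op_mult)
  qed simp
qed

lemma poly_left_intertwine: "c * poly_left (d * c) f x = poly_left (c * d) f (c * x)"
proof -
  interpret dc: linear_operator scl "\<lambda>x. (d * c) * x" by (rule linear_operator_left)
  interpret cd: linear_operator scl "\<lambda>x. (c * d) * x" by (rule linear_operator_left)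
  show ?thesis
  proof (induction f)
    case (pCons a f)
    have "c * poly_left (d * c) (pCons a f) x
        = c * scl (complex_of_real a) x + c * ((d * c) * poly_left (d * c) f x)"
      by (simp only: dc.poly_op_pCons distrib_left)
    also have "\<dots> = scl (complex_of_real a) (c * x) + (c * d) * (c * poly_left (d * c) f x)"
      by (simp only: scale_mult_right mult.assoc)
    finally show ?case by (simp only: cd.poly_op_pCons pCons.IH)
  qed simp
qed

lemma p_le_if_left_mult_le:
  assumes "star k = k" "\<And>x. p (k * x) \<le> m * p x" "0 \<le> m"
  shows "p k \<le> m"
proof -
  have "p k * p k \<le> m * p k"
    using assms(2)[of k] self.p_star_mult[of k] assms(1) by (simp add: power2_eq_square)
  then show ?thesis
    using self.p_nonneg[of k] assms(3) by (cases "p k = 0") (auto simp: mult_le_cancel_right)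
qed

text \<open>
  Squares \<open>b\<^sup>*b\<close> have spectrum in \<open>[0, \<infinity>)\<close>. If \<open>h = b\<^sup>*b\<close> had negative spectrum, then a suitable
  polynomial \<open>f\<close> would give \<open>c = b f(h)\<close> such that the spectrum of \<open>k = c\<^sup>*c = h f(h)\<^sup>2\<close> lies in
  \<open>[-\<mu>, \<mu> / 2]\<close> and contains \<open>-\<mu>\<close>. As \<open>c\<^sup>*c + cc\<^sup>*\<close> is a sum of squares of self-adjoint elements,
  the spectrum of \<open>l = cc\<^sup>*\<close> lies in \<open>[-\<mu> / 2, \<mu>]\<close>. Since \<open>k\<^sup>2 (\<mu> - k)\<^sup>2 = c\<^sup>* l (\<mu> - l)\<^sup>2 c\<close>, the
  value \<open>4 \<mu>\<^sup>4\<close> of \<open>t\<^sup>2 (\<mu> - t)\<^sup>2\<close> at \<open>-\<mu>\<close> would be at most \<open>\<mu>\<close> times the supremum of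
  \<open>\<bar>t\<bar> (\<mu> - t)\<^sup>2\<close> over \<open>[-\<mu> / 2, \<mu>]\<close>, which is \<open>9 \<mu>\<^sup>3 / 8\<close>.
\<close>

theorem spectrum_ge_star_mult: "spectrum_ge (star b * b) 0"
proof (rule ccontr)
  assume neg: "\<not> spectrum_ge (star b * b) 0"
  define h where "h = star b * b"
  have h: "star h = h" by (simp add: h_def star_mult star_star)
  interpret h: linear_operator scl "\<lambda>x. h * x" by (rule linear_operator_left)
  obtain \<sigma> where \<sigma>: "compact \<sigma>"
    "\<And>f C. 0 \<le> C \<Longrightarrow> (\<forall>x. p (poly_left h f x) \<le> C * p x) \<longleftrightarrow> (\<forall>t\<in>\<sigma>. \<bar>poly f t\<bar> \<le> C)"
    using spectrum_element[OF h] by blast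
  obtain t1 where t1: "t1 \<in> \<sigma>" "t1 < 0"
    using neg spectrum_ge_iff[OF \<sigma>] by (auto simp: h_def not_le)
  obtain M where M: "\<And>t. t \<in> \<sigma> \<Longrightarrow> \<bar>t\<bar> \<le> M" "M > 0"
    using compact_imp_bounded[OF \<sigma>(1)] by (auto simp: bounded_pos)
  \<comment> \<open>With this \<open>n\<close>, \<open>t f(t)\<^sup>2\<close> is at most \<open>M\<close> on \<open>[0, M]\<close>, but at most \<open>-2 M\<close> at \<open>t1\<close>.\<close>
  obtain n where n: "2 * M / (- t1) < (1 - t1 / M) ^ n"
    using real_arch_pow[of "1 - t1 / M" "2 * M / (- t1)"] t1(2) M(2)
    by (auto simp: divide_neg_pos)
  define f where "f = [:1, - (1 / M):] ^ n"
  define \<phi> where "\<phi> t = t * (poly f t)\<^sup>2" for t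
  have f: "poly f t = (1 - t / M) ^ n" for t by (simp add: f_def)
  have \<phi>_le: "\<phi> t \<le> M" if "t \<in> \<sigma>" for t
  proof (cases "t \<le> 0")
    case True
    then show ?thesis using M(2) by (simp add: \<phi>_def mult_nonpos_nonneg order_trans[of _ 0])
  next
    case False
    have "\<bar>t\<bar> \<le> M" by (rule M(1)[OF that])
    then have "0 \<le> poly f t" "poly f t \<le> 1"
      using False M(2) by (auto simp: f intro!: power_le_one)
    then have "(poly f t)\<^sup>2 \<le> 1" by (intro power_le_one)
    then have "t * (poly f t)\<^sup>2 \<le> t * 1" using False by (intro mult_left_mono) auto
    then show ?thesis using \<open>\<bar>t\<bar> \<le> M\<close> by (simp add: \<phi>_def)
  qed
  have "\<phi> t1 \<le> - (2 * M)"
  proof -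
    have 1: "1 \<le> (1 - t1 / M) ^ n" using t1(2) M(2) by (intro one_le_power) (simp add: divide_neg_pos less_imp_le)
    have "2 * M < (- t1) * (1 - t1 / M) ^ n" using n t1(2) by (simp add: field_simps)
    also have "\<dots> \<le> (- t1) * ((1 - t1 / M) ^ n * (1 - t1 / M) ^ n)"
      using t1(2) 1 mult_left_mono[OF 1, of "(1 - t1 / M) ^ n"] by (intro mult_left_mono) auto
    finally show ?thesis by (simp add: \<phi>_def f power2_eq_square)
  qed
  moreover have "continuous_on \<sigma> \<phi>" unfolding \<phi>_def by (intro continuous_intros)
  then obtain t0 where t0: "t0 \<in> \<sigma>" "\<And>t. t \<in> \<sigma> \<Longrightarrow> \<phi> t0 \<le> \<phi> t"
    using continuous_attains_inf[OF \<sigma>(1)] t1(1) by blast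
  define \<mu> where "\<mu> = - \<phi> t0"
  ultimately have \<mu>: "2 * M \<le> \<mu>" using t0(2)[OF t1(1)] by simp
  then have "\<mu> > 0" using M(2) by linarith
  have \<phi>_abs: "\<bar>\<phi> t\<bar> \<le> \<mu>" if "t \<in> \<sigma>" for t
    using t0(2)[OF that] \<phi>_le[OF that] \<mu> M(2) unfolding \<mu>_def by linarith
  define c where "c = star (poly_left h f (star b))"
  define g where "g = f * [:0, 1:] * f"
  have g: "poly g t = \<phi> t" for t by (simp add: g_def \<phi>_def power2_eq_square)
  have c_mult: "c * x = b * poly_left h f x" for x
    unfolding c_def
  proof (induction f arbitrary: x)
    case (pCons a f)
    have "star (poly_left h (pCons a f) (star b)) * x =
        scl (complex_of_real a) (b * x) + star (poly_left h f (star b)) * (h * x)"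
      by (simp add: star_add star_scale star_star star_mult h distrib_right scale_mult_left mult.assoc)
    also have "\<dots> = b * poly_left h (pCons a f) x"
      by (simp add: pCons.IH h.poly_op_commute distrib_left scale_mult_right)
    finally show ?case .
  qed (use star_scale[of 0 0] in simp)
  have star_c_mult: "star c * x = poly_left h f (star b * x)" for x
  proof -
    have "poly_left h f y * x = poly_left h f (y * x)" for y
      by (induction f) (simp_all add: distrib_right scale_mult_left mult.assoc)
    then show ?thesis by (simp add: c_def star_star)
  qed
  define k where "k = star c * c"
  define l where "l = c * star c"
  have sa: "star k = k" "star l = l" by (simp_all add: k_def l_def star_mult star_star)
  have k_mult: "k * x = poly_left h g x" for x
  proof -
    have "k * x = star c * (c * x)" by (simp only: k_def mult.assoc)
    also have "\<dots> = poly_left h f ((star b * b) * poly_left h f x)"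
      by (simp only: c_mult star_c_mult mult.assoc)
    also have "\<dots> = poly_left h f (h * poly_left h f x)" by (simp only: h_def)
    also have "\<dots> = poly_left h f (poly_left h [:0, 1:] (poly_left h f x))"
      by simp
    finally show ?thesis by (simp only: g_def h.poly_op_mult)
  qed
  have "p k \<le> \<mu>"
  proof (rule p_le_if_left_mult_le[OF sa(1)])
    show "p (k * x) \<le> \<mu> * p x" for x
      using \<sigma>(2)[of \<mu> g] \<phi>_abs \<open>\<mu> > 0\<close> by (simp add: k_mult g)
  qed (use \<open>\<mu> > 0\<close> in simp)
  then have pc: "p c * p c \<le> \<mu>" using self.p_star_mult[of c] by (simp add: k_def power2_eq_square)
  have "spectrum_ge (- k) (- M)"
  proof -
    have "p (scl (complex_of_real (r + - M)) x - - k * x) \<le> r * p x" if "r \<ge> M + \<mu>" for r x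
    proof -
      have "\<forall>t\<in>\<sigma>. \<bar>poly ([:r - M:] + g) t\<bar> \<le> r"
      proof
        fix t assume "t \<in> \<sigma>"
        then show "\<bar>poly ([:r - M:] + g) t\<bar> \<le> r"
          using \<phi>_le[of t] \<phi>_abs[of t] that M(2) by (simp add: g abs_le_iff)
      qed
      then have "p (poly_left h ([:r - M:] + g) x) \<le> r * p x"
        using \<sigma>(2)[of r "[:r - M:] + g"] that M(2) \<open>\<mu> > 0\<close> by simp
      moreover have "poly_left h ([:r - M:] + g) x = scl (complex_of_real (r + - M)) x - - k * x"
        by (simp add: h.poly_op_add k_mult)
      ultimately show ?thesis by metis
    qed
    then show ?thesis unfolding spectrum_ge_def by blast
  qed
  moreover define u where "u = c + star c"
  moreover define v where "v = scl \<i> (c - star c)"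
  have "star u = u" by (simp add: u_def star_add star_star add.commute)
  moreover have "star v = v"
  proof -
    have anti: "star (c - star c) = - (c - star c)"
      using star_add[of c "- star c"] by (simp add: star_minus star_star)
    show ?thesis
      by (simp only: v_def star_scale anti complex_cnj_i scale_minus_left scale_minus_right minus_minus)
  qed
  ultimately have sum_ge: "spectrum_ge (u * u + v * v + (- k + - k)) (0 + 0 + (- M + - M))"
    by (intro spectrum_ge_add spectrum_ge_square) auto
  have "v * v = - ((c - star c) * (c - star c))"
    by (simp add: v_def scale_mult_left[symmetric] scale_mult_right[symmetric])
  moreover have "(x + y) * (x + y) + - ((x - y) * (x - y)) + (- (y * x) + - (y * x)) = x * y + x * y"
    for x y :: 'a
    by (simp add: distrib_left distrib_right left_diff_distrib right_diff_distrib)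
  ultimately have sum_eq: "u * u + v * v + (- k + - k) = l + l"
    by (simp only: u_def k_def l_def)
  have "spectrum_ge (l + l) (- M + - M)"
    using sum_ge by (simp only: sum_eq add_0_left)
  then have l_ge: "spectrum_ge l (- M)" by (rule spectrum_ge_half)
  interpret l: linear_operator scl "\<lambda>x. l * x" by (rule linear_operator_left)
  obtain \<tau> where \<tau>: "compact \<tau>"
    "\<And>f C. 0 \<le> C \<Longrightarrow> (\<forall>x. p (poly_left l f x) \<le> C * p x) \<longleftrightarrow> (\<forall>t\<in>\<tau>. \<bar>poly f t\<bar> \<le> C)"
    using spectrum_element[OF sa(2)] by blast
  have \<tau>_ge: "- M \<le> t" if "t \<in> \<tau>" for t
    using l_ge spectrum_ge_iff[OF \<tau>] that by blast
  have "p (poly_left l [:0, 1:] x) \<le> \<mu> * p x" for x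
  proof -
    have "p (poly_left l [:0, 1:] x) \<le> p l * p x" by (simp add: self.p_mult)
    also have "\<dots> \<le> \<mu> * p x"
      using self.p_mult[of c "star c"] pc self.p_star[of c] self.p_nonneg
      by (intro mult_right_mono) (auto simp: l_def)
    finally show ?thesis .
  qed
  then have \<tau>_le: "\<bar>t\<bar> \<le> \<mu>" if "t \<in> \<tau>" for t
    using \<tau>(2)[of \<mu> "[:0, 1:]"] \<open>\<mu> > 0\<close> that by simp
  define H where "H = [:0, 1:] * [:\<mu>, -1:]\<^sup>2"
  have H: "poly H t = t * (\<mu> - t)\<^sup>2" for t by (simp add: H_def)
  have H_le: "\<bar>poly H t\<bar> \<le> 9 / 8 * \<mu> ^ 3" if "t \<in> \<tau>" for t
  proof (cases "t \<ge> 0")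
    case True
    have "\<bar>poly H t\<bar> = t * (\<mu> - t)\<^sup>2" using True by (simp add: H)
    also have "\<dots> \<le> \<mu> * \<mu>\<^sup>2" using True \<tau>_le[OF that] by (intro mult_mono power_mono) auto
    also have "\<dots> \<le> 9 / 8 * \<mu> ^ 3" using \<open>\<mu> > 0\<close> by (simp add: power3_eq_cube power2_eq_square)
    finally show ?thesis .
  next
    case False
    have "\<bar>poly H t\<bar> = (- t) * (\<mu> - t)\<^sup>2" using False by (simp add: H abs_mult)
    also have "\<dots> \<le> (\<mu> / 2) * (3 / 2 * \<mu>)\<^sup>2"
      using False \<tau>_ge[OF that] \<mu> \<open>\<mu> > 0\<close> by (intro mult_mono power_mono) auto
    also have "\<dots> = 9 / 8 * \<mu> ^ 3" by (simp add: power3_eq_cube power2_eq_square)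
    finally show ?thesis .
  qed
  have "p (poly_left h (g * pcompose H g) x) \<le> 9 / 8 * \<mu> ^ 4 * p x" for x
  proof -
    have "poly_left h (g * pcompose H g) x = k * poly_left k H x"
      by (simp only: h.poly_op_mult poly_left_pcompose[of k h g, OF k_mult] k_mult[of "poly_left h _ _"])
    also have "\<dots> = star c * poly_left l H (c * x)"
      unfolding l_def poly_left_intertwine[of c "star c" H x, symmetric] k_def by (rule mult.assoc)
    finally have "p (poly_left h (g * pcompose H g) x) \<le> p c * p (poly_left l H (c * x))"
      using self.p_mult[of "star c"] self.p_star[of c] by simp
    also have "\<dots> \<le> p c * (9 / 8 * \<mu> ^ 3 * p (c * x))"
      using \<tau>(2)[of "9 / 8 * \<mu> ^ 3" H] H_le \<open>\<mu> > 0\<close> self.p_nonneg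
      by (intro mult_left_mono) auto
    also have "\<dots> \<le> p c * (9 / 8 * \<mu> ^ 3 * (p c * p x))"
      using \<open>\<mu> > 0\<close> self.p_nonneg self.p_mult by (intro mult_left_mono) auto
    also have "\<dots> = (p c * p c) * (9 / 8 * \<mu> ^ 3 * p x)" by simp
    also have "\<dots> \<le> \<mu> * (9 / 8 * \<mu> ^ 3 * p x)"
      using \<open>\<mu> > 0\<close> self.p_nonneg pc by (intro mult_right_mono) auto
    finally show ?thesis by (simp add: power_numeral_reduce)
  qed
  then have "\<bar>poly (g * pcompose H g) t0\<bar> \<le> 9 / 8 * \<mu> ^ 4"
    using \<sigma>(2)[of "9 / 8 * \<mu> ^ 4" "g * pcompose H g"] \<open>\<mu> > 0\<close> t0(1) by simp
  moreover have "poly (g * pcompose H g) t0 = 4 * \<mu> ^ 4"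
    by (simp add: poly_pcompose g H \<mu>_def power_numeral_reduce algebra_simps)
  ultimately show False using zero_less_power[OF \<open>\<mu> > 0\<close>, of 4] by simp
qed

theorem p_star_mult_mono: "p (star a * a) \<le> p (star a * a + star b * b)"
proof -
  define u where "u = star a * a"
  define d where "d = star a * a + star b * b"
  have u: "star u = u" by (simp add: u_def star_mult star_star)
  interpret u: linear_operator scl "\<lambda>x. u * x" by (rule linear_operator_left)
  obtain \<sigma> where \<sigma>: "compact \<sigma>"
    "\<And>f C. 0 \<le> C \<Longrightarrow> (\<forall>x. p (poly_left u f x) \<le> C * p x) \<longleftrightarrow> (\<forall>t\<in>\<sigma>. \<bar>poly f t\<bar> \<le> C)"
    using spectrum_element[OF u] by blast
  have ge: "0 \<le> t" if "t \<in> \<sigma>" for t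
    using spectrum_ge_iff[OF \<sigma>] spectrum_ge_star_mult that by (auto simp: u_def)
  have "spectrum_ge (- d) (- p d)"
  proof -
    have "p (scl (complex_of_real (r + - p d)) x - - d * x) \<le> r * p x" if "r \<ge> p d" for r x
    proof -
      have "p (scl (complex_of_real (r + - p d)) x - - d * x)
          \<le> p (scl (complex_of_real (r + - p d)) x) + p (d * x)"
        using self.p_add[of "scl (complex_of_real (r + - p d)) x" "d * x"] by simp
      also have "\<dots> \<le> (r - p d) * p x + p d * p x"
        using that self.p_mult[of d x] by (simp add: self.p_scale flip: of_real_diff)
      finally show ?thesis by (simp add: algebra_simps)
    qed
    then show ?thesis unfolding spectrum_ge_def by blast
  qed
  then have "spectrum_ge (- d + star b * b) (- p d + 0)"
    by (intro spectrum_ge_add spectrum_ge_star_mult)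
  moreover have "- d + star b * b = - u" by (simp add: d_def u_def)
  ultimately obtain r0 where r0:
    "\<And>r x. r \<ge> r0 \<Longrightarrow> p (scl (complex_of_real (r + - p d)) x - - u * x) \<le> r * p x"
    unfolding spectrum_ge_def by auto
  define r where "r = max r0 0"
  have "poly_left u [:r + - p d, 1:] x = scl (complex_of_real (r + - p d)) x - - u * x" for x
    by simp
  then have "\<forall>x. p (poly_left u [:r + - p d, 1:] x) \<le> r * p x"
    using r0[of r] by (simp add: r_def)
  then have "\<forall>t\<in>\<sigma>. \<bar>poly [:r + - p d, 1:] t\<bar> \<le> r"
    using \<sigma>(2)[of r] by (simp only: r_def max.cobounded2)
  then have "\<forall>t\<in>\<sigma>. \<bar>poly [:0, 1:] t\<bar> \<le> p d" using ge by fastforce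
  then have "\<forall>x. p (poly_left u [:0, 1:] x) \<le> p d * p x"
    using \<sigma>(2)[of "p d"] self.p_nonneg by blast
  then have "p u \<le> p d"
    using self.p_nonneg by (intro p_le_if_left_mult_le[OF u]) auto
  then show ?thesis by (simp add: u_def d_def)
qed

end

section \<open>The Cauchy-Schwarz inequality in Hilbert modules\<close>

context right_hilbert_module
begin

abbreviation S_A :: "('a \<Rightarrow> real) set" where
  "S_A \<equiv> continuous_cstar_seminorms scaleA star"

abbreviation L_E :: "('e \<Rightarrow> 'e) set" where
  "L_E \<equiv> adjointable_operators scaleA star scaleE act ip"

abbreviation K_E :: "('e \<Rightarrow> 'e) set" where
  "K_E \<equiv> compact_operators scaleA star scaleE act ip"

abbreviation nrm :: "('a \<Rightarrow> real) \<Rightarrow> 'e \<Rightarrow> real" where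
  "nrm p \<equiv> module_seminorm ip p"

abbreviation opnrm :: "('a \<Rightarrow> real) \<Rightarrow> ('e \<Rightarrow> 'e) \<Rightarrow> real" where
  "opnrm p \<equiv> operator_seminorm ip p"

lemma ip_add_left: "ip (x + y) z = ip x z + ip y z"
  by (subst (1 2 3) ip_star) (simp add: ip_add_right A.star_add)

lemma ip_scale_left: "ip (scaleE c x) z = scaleA (cnj c) (ip x z)"
  by (subst (1 2) ip_star) (simp add: ip_scale_right A.star_scale)

lemma ip_act_left: "ip (act x a) y = star a * ip x y"
  by (subst (1 2) ip_star) (simp add: ip_act_right A.star_mult)

lemma ip_diff_right: "ip x (y - z) = ip x y - ip x z"
  using ip_add_right[of x "y - z" z] by (simp add: algebra_simps)

lemma ip_diff_left: "ip (x - y) z = ip x z - ip y z"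
  using ip_add_left[of "x - y" y z] by (simp add: algebra_simps)

lemma cstar_seminorm_S: "p \<in> S_A \<Longrightarrow> cstar_seminorm scaleA star p"
  by (simp add: continuous_cstar_seminorms_def)

text \<open>With \<open>c = \<langle>y, x\<rangle>\<close>, positivity of \<open>\<langle>z, z\<rangle>\<close> for \<open>z = s y c - x\<close> gives
  \<open>2 s c\<^sup>*c \<le> s\<^sup>2 c\<^sup>*\<langle>y, y\<rangle>c + \<langle>x, x\<rangle>\<close>; the seminorm is monotone on positive elements.\<close>

theorem cauchy_schwarz:
  assumes "p \<in> S_A"
  shows "(p (ip x y))\<^sup>2 \<le> p (ip x x) * p (ip y y)"
proof -
  interpret P: cstar_seminormed_algebra scaleA star p
    using cstar_seminorm_S[OF assms] by unfold_locales
  define c where "c = ip y x"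
  have star_c: "star c = ip x y" unfolding c_def by (rule ip_star[symmetric])
  have key: "2 * s * (p c)\<^sup>2 \<le> s\<^sup>2 * (p (ip y y) * (p c)\<^sup>2) + p (ip x x)" if "s > 0" for s :: real
  proof -
    define z where "z = scaleE (complex_of_real s) (act y c) - x"
    define a where "a = scaleA (complex_of_real (sqrt (2 * s))) c"
    obtain b where b: "ip z z = star b * b"
      using ip_positive unfolding positive_element_def by blast
    have "complex_of_real (sqrt (2 * s)) * complex_of_real (sqrt (2 * s)) = complex_of_real (s + s)"
      using \<open>s > 0\<close> by (simp only: flip: of_real_mult) simp
    then have "star a * a = scaleA (complex_of_real (s + s)) (star c * c)"
      by (simp only: a_def A.star_scale complex_cnj_complex_of_real A.scale_mult_left[symmetric]
         A.scale_mult_right[symmetric] A.scale_scale)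
    moreover have "ip z z = scaleA (complex_of_real (s * s)) (star c * ip y y * c)
        - scaleA (complex_of_real (s + s)) (star c * c) + ip x x"
    proof -
      let ?w = "act y c" and ?s = "complex_of_real s"
      have w: "ip ?w ?w = star c * ip y y * c" "ip ?w x = star c * c" "ip x ?w = star c * c"
        by (simp_all only: ip_act_left ip_act_right star_c[symmetric] c_def[symmetric] mult.assoc)
      have "ip z z = (scaleA ?s (scaleA ?s (ip ?w ?w)) - scaleA ?s (ip x ?w)) - (scaleA ?s (ip ?w x) - ip x x)"
        by (simp only: z_def ip_diff_left ip_diff_right ip_scale_left ip_scale_right
            complex_cnj_complex_of_real A.scale_right_diff_distrib)
      then show ?thesis by (simp only: w A.scale_scale A.scale_left_distrib of_real_add of_real_mult) simp
    qed
    ultimately have "star a * a + star b * b = scaleA (complex_of_real (s * s)) (star c * ip y y * c) + ip x x"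
      using b by (simp add: algebra_simps)
    moreover have "p (star a * a) = 2 * s * (p c)\<^sup>2"
      using \<open>s > 0\<close> by (simp add: P.self.p_star_mult a_def P.self.p_scale power_mult_distrib)
    ultimately have "2 * s * (p c)\<^sup>2 \<le> p (scaleA (complex_of_real (s * s)) (star c * ip y y * c) + ip x x)"
      using P.p_star_mult_mono[of a b] by simp
    also have "\<dots> \<le> p (scaleA (complex_of_real (s * s)) (star c * ip y y * c)) + p (ip x x)"
      by (rule P.self.p_add)
    also have "p (scaleA (complex_of_real (s * s)) (star c * ip y y * c)) = s\<^sup>2 * p (star c * ip y y * c)"
      by (simp only: P.self.p_scale) (simp add: power2_eq_square norm_mult)
    also have "s\<^sup>2 * p (star c * ip y y * c) \<le> s\<^sup>2 * (p (ip y y) * (p c)\<^sup>2)"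
    proof (rule mult_left_mono)
      have "p (star c * ip y y * c) \<le> p (star c * ip y y) * p c" by (rule P.self.p_mult)
      also have "\<dots> \<le> (p (star c) * p (ip y y)) * p c"
        by (intro mult_right_mono P.self.p_mult P.self.p_nonneg)
      finally show "p (star c * ip y y * c) \<le> p (ip y y) * (p c)\<^sup>2"
        by (simp add: P.self.p_star power2_eq_square mult_ac)
    qed simp
    finally show ?thesis by simp
  qed
  have "(p c)\<^sup>2 \<le> p (ip x x) * p (ip y y)"
  proof (cases "p (ip y y) = 0")
    case True
    show ?thesis
    proof (cases "p c = 0")
      case False
      then have pos: "(p c)\<^sup>2 > 0" by simp
      define s where "s = (p (ip x x) + 1) / (p c)\<^sup>2"
      have "s > 0" using pos P.self.p_nonneg[of "ip x x"] by (simp add: s_def)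
      then have "2 * s * (p c)\<^sup>2 \<le> p (ip x x)" using key True by simp
      moreover have "2 * s * (p c)\<^sup>2 = 2 * (p (ip x x) + 1)" using pos by (simp add: s_def)
      ultimately show ?thesis using P.self.p_nonneg[of "ip x x"] by simp
    qed (use True in simp)
  next
    case False
    then have pos: "p (ip y y) > 0" using P.self.p_nonneg[of "ip y y"] by simp
    let ?m = "p (ip y y)"
    have "2 * (1 / ?m) * (p c)\<^sup>2 \<le> (1 / ?m)\<^sup>2 * (?m * (p c)\<^sup>2) + p (ip x x)"
      using pos by (intro key) simp
    moreover have "(1 / ?m)\<^sup>2 * (?m * (p c)\<^sup>2) = (1 / ?m) * (p c)\<^sup>2"
      using pos by (simp add: power2_eq_square)
    ultimately have "(p c)\<^sup>2 / ?m \<le> p (ip x x)" by simp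
    then show ?thesis using pos by (simp add: divide_le_eq)
  qed
  then show ?thesis using P.self.p_star[of c] star_c by simp
qed

lemma module_S: "p \<in> S_A \<Longrightarrow> cauchy_schwarz_module scaleA star scaleE ip p"
  by (intro cauchy_schwarz_module.intro cauchy_schwarz_module_axioms.intro A.complex_star_algebra_axioms
      E.vector_space_axioms cstar_seminorm_S ip_add_right ip_scale_right ip_star cauchy_schwarz)

lemma seminorms_separate:
  assumes "\<And>p. p \<in> S_A \<Longrightarrow> p a = 0"
  shows "a = 0"
proof (rule ccontr)
  assume "a \<noteq> 0"
  then obtain U where U: "open U" "0 \<in> U" "a \<notin> U" by (metis t1_space)
  have "(p \<longlongrightarrow> 0) (principal {a})" if "p \<in> S_A" for p
    using assms[OF that] by (auto intro!: tendstoI simp: eventually_principal)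
  then have "principal {a} \<le> nhds 0" using A.nhds_0_iff by blast
  then have "eventually (\<lambda>x. x \<in> U) (principal {a})"
    using filter_leD eventually_nhds_in_open[OF U(1,2)] by blast
  then show False using U by (simp add: eventually_principal)
qed

lemma nrm_separate:
  assumes "\<And>p. p \<in> S_A \<Longrightarrow> nrm p x = 0"
  shows "x = 0"
proof -
  have "p (ip x x) = 0" if "p \<in> S_A" for p
    using assms[OF that] cauchy_schwarz_module.nrm_square[OF module_S[OF that], of x] by simp
  then show ?thesis using seminorms_separate ip_eq_0_iff by blast
qed

lemma ip_right_eqI:
  assumes "\<And>z. ip z x = ip z y"
  shows "x = y"
  using assms[of "x - y"] ip_eq_0_iff[of "x - y"] by (simp add: ip_diff_right)

section \<open>Adjointable operators\<close>

text \<open>Linearity and \<open>A\<close>-linearity of an operator follow from the existence of an adjoint.\<close>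

lemma L_I:
  assumes adj: "\<And>x y. ip (T x) y = ip x (T' y)"
    and bd: "\<And>p. p \<in> S_A \<Longrightarrow> \<exists>M. \<forall>x. nrm p (T x) \<le> M * nrm p x"
  shows "T \<in> L_E"
proof -
  have right: "ip z (T x) = ip (T' z) x" for x z
    by (metis adj ip_star)
  have "T (x + y) = T x + T y" for x y
    by (rule ip_right_eqI) (simp add: right ip_add_right)
  moreover have "T (scaleE c x) = scaleE c (T x)" for c x
    by (rule ip_right_eqI) (simp add: right ip_scale_right)
  moreover have "T (act x a) = act (T x) a" for a x
    by (rule ip_right_eqI) (simp add: right ip_act_right)
  ultimately show ?thesis
    using adj bd unfolding adjointable_operators_def adjointable_def by blast
qed

lemma L_D:
  assumes "T \<in> L_E"
  shows "T (x + y) = T x + T y" "T (scaleE c x) = scaleE c (T x)" "T (act x a) = act (T x) a"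
  using assms unfolding adjointable_operators_def by auto

lemma L_bounded: "T \<in> L_E \<Longrightarrow> p \<in> S_A \<Longrightarrow> \<exists>M. \<forall>x. nrm p (T x) \<le> M * nrm p x"
  unfolding adjointable_operators_def by auto

lemma L_diff_arg: "T \<in> L_E \<Longrightarrow> T (x - y) = T x - T y"
  using L_D(1)[of T "x - y" y] by (simp add: algebra_simps)

lemma nrm_le: "T \<in> L_E \<Longrightarrow> p \<in> S_A \<Longrightarrow> nrm p (T x) \<le> opnrm p T * nrm p x"
  using L_bounded[of T p] L_D(2) cauchy_schwarz_module.nrm_le_opnrm[OF module_S, of p T] by metis

lemma opnrm_nonneg: "T \<in> L_E \<Longrightarrow> p \<in> S_A \<Longrightarrow> 0 \<le> opnrm p T"
  using L_bounded[of T p] L_D(2) cauchy_schwarz_module.opnrm_nonneg[OF module_S, of p T] by metis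

lemmas opnrm_le = cauchy_schwarz_module.opnrm_le[OF module_S]
lemmas nrm_nonneg = cauchy_schwarz_module.nrm_nonneg[OF module_S]
lemmas nrm_add = cauchy_schwarz_module.nrm_add[OF module_S]
lemmas nrm_diff = cauchy_schwarz_module.nrm_diff[OF module_S]
lemmas nrm_minus = cauchy_schwarz_module.nrm_minus[OF module_S]
lemmas nrm_scale = cauchy_schwarz_module.nrm_scale[OF module_S]
lemmas nrm_zero = cauchy_schwarz_module.nrm_zero[OF module_S]
lemmas nrm_square = cauchy_schwarz_module.nrm_square[OF module_S]
lemmas p_ip_le = cauchy_schwarz_module.p_ip_le[OF module_S]

text \<open>The adjoint of an operator in \<open>L_E\<close>, which is unique by nondegeneracy (\<open>adj_eqI\<close>); an
  unspecified map for operators without an adjoint.\<close>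

definition adj :: "('e \<Rightarrow> 'e) \<Rightarrow> 'e \<Rightarrow> 'e" where
  "adj T = (SOME T'. \<forall>x y. ip (T x) y = ip x (T' y))"

lemma adj_left: "T \<in> L_E \<Longrightarrow> ip (T x) y = ip x (adj T y)"
  unfolding adj_def adjointable_operators_def adjointable_def
  by (rule someI2_ex[where Q = "\<lambda>T'. ip (T x) y = ip x (T' y)"]) auto

lemma adj_right: "T \<in> L_E \<Longrightarrow> ip x (T y) = ip (adj T x) y"
  by (metis adj_left ip_star)

lemma adj_eqI: "T \<in> L_E \<Longrightarrow> (\<And>x y. ip (T x) y = ip x (T' y)) \<Longrightarrow> adj T = T'"
  by (rule ext, rule ip_right_eqI) (metis adj_left)

lemma nrm_adj_le:
  assumes "T \<in> L_E" "p \<in> S_A"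
  shows "nrm p (adj T x) \<le> opnrm p T * nrm p x"
proof (cases "nrm p (adj T x) = 0")
  case True
  then show ?thesis using assms opnrm_nonneg nrm_nonneg by (simp add: mult_nonneg_nonneg)
next
  case False
  then have pos: "nrm p (adj T x) > 0" using nrm_nonneg[OF assms(2), of "adj T x"] by simp
  have "(nrm p (adj T x))\<^sup>2 = p (ip (T (adj T x)) x)"
    using assms by (simp add: nrm_square adj_left)
  also have "\<dots> \<le> nrm p (T (adj T x)) * nrm p x" by (rule p_ip_le[OF assms(2)])
  also have "\<dots> \<le> (opnrm p T * nrm p (adj T x)) * nrm p x"
    using assms by (intro mult_right_mono nrm_le nrm_nonneg)
  finally show ?thesis using pos by (simp add: power2_eq_square mult_ac)
qed

lemma adj_in_L: "T \<in> L_E \<Longrightarrow> adj T \<in> L_E"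
  using nrm_adj_le by (intro L_I[of _ T]) (auto simp: adj_right)

lemma opnrm_adj_le: "T \<in> L_E \<Longrightarrow> p \<in> S_A \<Longrightarrow> opnrm p (adj T) \<le> opnrm p T"
  by (intro opnrm_le opnrm_nonneg nrm_adj_le)

lemma nrm_comp_le:
  assumes "T \<in> L_E" "U \<in> L_E" "p \<in> S_A"
  shows "nrm p (T (U x)) \<le> opnrm p T * opnrm p U * nrm p x"
proof -
  have "nrm p (T (U x)) \<le> opnrm p T * nrm p (U x)" using assms by (intro nrm_le)
  also have "\<dots> \<le> opnrm p T * (opnrm p U * nrm p x)"
    using assms by (intro mult_left_mono nrm_le opnrm_nonneg)
  finally show ?thesis by (simp add: mult.assoc)
qed

lemma comp_in_L:
  assumes "T \<in> L_E" "U \<in> L_E"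
  shows "T \<circ> U \<in> L_E"
proof (rule L_I[of _ "adj U \<circ> adj T"])
  show "ip ((T \<circ> U) x) y = ip x ((adj U \<circ> adj T) y)" for x y
    using assms by (simp add: adj_left)
  show "\<exists>M. \<forall>x. nrm p ((T \<circ> U) x) \<le> M * nrm p x" if "p \<in> S_A" for p
    using nrm_comp_le[OF assms that] by auto
qed

lemma opnrm_comp_le:
  assumes "T \<in> L_E" "U \<in> L_E" "p \<in> S_A"
  shows "opnrm p (T \<circ> U) \<le> opnrm p T * opnrm p U"
  using assms nrm_comp_le by (intro opnrm_le) (auto simp: opnrm_nonneg)

lemma nrm_plus_le:
  assumes "T \<in> L_E" "U \<in> L_E" "p \<in> S_A"
  shows "nrm p ((T + U) x) \<le> (opnrm p T + opnrm p U) * nrm p x"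
proof -
  have "nrm p ((T + U) x) \<le> nrm p (T x) + nrm p (U x)" using nrm_add[OF assms(3)] by simp
  also have "\<dots> \<le> opnrm p T * nrm p x + opnrm p U * nrm p x" using assms by (intro add_mono nrm_le)
  finally show ?thesis by (simp add: distrib_right)
qed

lemma add_in_L:
  assumes "T \<in> L_E" "U \<in> L_E"
  shows "T + U \<in> L_E"
proof (rule L_I[of _ "adj T + adj U"])
  show "ip ((T + U) x) y = ip x ((adj T + adj U) y)" for x y
    using assms by (simp add: adj_left ip_add_left ip_add_right)
  show "\<exists>M. \<forall>x. nrm p ((T + U) x) \<le> M * nrm p x" if "p \<in> S_A" for p
    using nrm_plus_le[OF assms that] by blast
qed

lemma opnrm_add_le:
  assumes "T \<in> L_E" "U \<in> L_E" "p \<in> S_A"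
  shows "opnrm p (T + U) \<le> opnrm p T + opnrm p U"
  using assms nrm_plus_le by (intro opnrm_le) (auto simp: opnrm_nonneg)

lemma nrm_scale_map_le:
  assumes "T \<in> L_E" "p \<in> S_A"
  shows "nrm p (scale_map scaleE c T x) \<le> cmod c * opnrm p T * nrm p x"
  using mult_left_mono[OF nrm_le[OF assms], of "cmod c" x] assms
  by (simp add: scale_map_def nrm_scale mult.assoc)

lemma scale_in_L:
  assumes "T \<in> L_E"
  shows "scale_map scaleE c T \<in> L_E"
proof (rule L_I[of _ "scale_map scaleE (cnj c) (adj T)"])
  show "ip (scale_map scaleE c T x) y = ip x (scale_map scaleE (cnj c) (adj T) y)" for x y
    using assms by (simp add: scale_map_def adj_left ip_scale_left ip_scale_right)
  show "\<exists>M. \<forall>x. nrm p (scale_map scaleE c T x) \<le> M * nrm p x" if "p \<in> S_A" for p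
    using nrm_scale_map_le[OF assms that] by blast
qed

lemma opnrm_scale_le:
  assumes "T \<in> L_E" "p \<in> S_A"
  shows "opnrm p (scale_map scaleE c T) \<le> cmod c * opnrm p T"
  using assms nrm_scale_map_le by (intro opnrm_le) (auto simp: opnrm_nonneg)

lemma minus_eq_scale: "- T = scale_map scaleE (-1) T"
  by (simp add: scale_map_def fun_eq_iff)

lemma diff_in_L: "T \<in> L_E \<Longrightarrow> U \<in> L_E \<Longrightarrow> T - U \<in> L_E"
  using add_in_L[of T "- U"] scale_in_L[of U "-1"] by (simp add: minus_eq_scale[symmetric])

lemma zero_in_L: "0 \<in> L_E"
proof (rule L_I[of _ 0])
  have "ip 0 x = 0" "ip x 0 = 0" for x
    using ip_scale_left[of 0 0 x] ip_scale_right[of x 0 0] by simp_all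
  then show "ip ((0 :: 'e \<Rightarrow> 'e) x) y = ip x ((0 :: 'e \<Rightarrow> 'e) y)" for x y by simp
  show "\<exists>M. \<forall>x. nrm p ((0 :: 'e \<Rightarrow> 'e) x) \<le> M * nrm p x" if "p \<in> S_A" for p
    by (intro exI[of _ 0]) (simp add: nrm_zero[OF that])
qed

lemma rank_one_adj: "ip (rank_one act ip x y \<xi>) \<eta> = ip \<xi> (rank_one act ip y x \<eta>)"
  by (simp add: rank_one_def ip_act_left ip_act_right ip_star[of y \<xi>] A.star_star)

lemma rank_one_in_L: "rank_one act ip x y \<in> L_E"
proof (rule L_I[of _ "rank_one act ip y x"])
  fix p assume p: "p \<in> S_A"
  interpret P: cauchy_schwarz_module scaleA star scaleE ip p by (rule module_S[OF p])
  have "nrm p (rank_one act ip x y \<xi>) \<le> nrm p x * nrm p y * nrm p \<xi>" for \<xi>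
  proof (rule power2_le_imp_le)
    let ?b = "ip y \<xi>"
    have "(nrm p (rank_one act ip x y \<xi>))\<^sup>2 = p (star ?b * ip x x * ?b)"
      using p by (simp add: nrm_square rank_one_def ip_act_left ip_act_right mult.assoc)
    also have "\<dots> \<le> p (star ?b * ip x x) * p ?b" by (rule P.p_mult)
    also have "\<dots> \<le> (p (star ?b) * p (ip x x)) * p ?b"
      by (intro mult_right_mono P.p_mult P.p_nonneg)
    also have "\<dots> = (nrm p x * p ?b)\<^sup>2"
      using p by (simp add: P.p_star nrm_square[symmetric] power2_eq_square mult_ac)
    also have "\<dots> \<le> (nrm p x * (nrm p y * nrm p \<xi>))\<^sup>2"
      using p by (intro power_mono mult_left_mono p_ip_le nrm_nonneg mult_nonneg_nonneg P.p_nonneg)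
    finally show "(nrm p (rank_one act ip x y \<xi>))\<^sup>2 \<le> (nrm p x * nrm p y * nrm p \<xi>)\<^sup>2"
      by (simp add: mult.assoc)
  qed (use p in \<open>simp add: nrm_nonneg\<close>)
  then show "\<exists>M. \<forall>\<xi>. nrm p (rank_one act ip x y \<xi>) \<le> M * nrm p \<xi>" by blast
qed (rule rank_one_adj)

section \<open>Compact operators\<close>

sublocale F: vector_space "scale_map scaleE"
  by unfold_locales
     (simp_all add: scale_map_def fun_eq_iff E.scale_right_distrib E.scale_left_distrib)

abbreviation K0 :: "('e \<Rightarrow> 'e) set" where
  "K0 \<equiv> F.span {rank_one act ip x y | x y. True}"

lemma K0_sub_L: "K0 \<subseteq> L_E"
proof
  fix V assume "V \<in> K0"
  then show "V \<in> L_E"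
    by (induction rule: F.span_induct_alt)
       (use zero_in_L add_in_L scale_in_L rank_one_in_L in blast)+
qed

text \<open>
  The seminorms define a subbasis, so that finitely many of them are approximated at the
  same time.
\<close>

lemma K_iff:
  "T \<in> K_E \<longleftrightarrow> T \<in> L_E \<and>
     (\<forall>P e. finite P \<and> P \<subseteq> S_A \<and> 0 < e \<longrightarrow> (\<exists>V\<in>K0. \<forall>p\<in>P. opnrm p (V - T) < e))"
proof -
  define B where "B = {{U \<in> L_E. opnrm p (U - T) < \<epsilon>} | p T \<epsilon>. p \<in> S_A \<and> T \<in> L_E \<and> 0 < \<epsilon>}"
  define X where "X = topology_generated_by B"
  have opnrm_0: "opnrm p 0 = 0" if "p \<in> S_A" for p
    using opnrm_le[OF that, of 0 0] opnrm_nonneg[OF zero_in_L that] by (simp add: nrm_zero[OF that])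
  have zero_S: "(\<lambda>_. 0) \<in> S_A"
    by (simp add: continuous_cstar_seminorms_def cstar_seminorm_def)
  have top: "topspace X = L_E"
  proof
    show "topspace X \<subseteq> L_E" unfolding X_def B_def topology_generated_by_topspace by blast
    show "L_E \<subseteq> topspace X"
    proof
      fix T assume T: "T \<in> L_E"
      then have "T \<in> {U \<in> L_E. opnrm (\<lambda>_. 0) (U - T) < 1}" by (simp add: opnrm_0[OF zero_S])
      moreover have "{U \<in> L_E. opnrm (\<lambda>_. 0) (U - T) < 1} \<in> B"
        unfolding B_def using T zero_S by (intro CollectI exI conjI refl) auto
      ultimately show "T \<in> topspace X" unfolding X_def topology_generated_by_topspace by (rule UnionI[rotated])
    qed
  qed
  have K: "K_E = X closure_of K0"
    unfolding compact_operators_def operator_topology_def Let_def X_def B_def ..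
  have ball: "openin X {U \<in> L_E. opnrm p (U - T) < \<epsilon>}" if "p \<in> S_A" "T \<in> L_E" "0 < \<epsilon>" for p T \<epsilon>
    unfolding X_def B_def using that by (intro topology_generated_by_Basis CollectI exI conjI refl) auto
  have nbhd: "T \<in> U \<longrightarrow> (\<exists>P e. finite P \<and> P \<subseteq> S_A \<and> 0 < e \<and> {V \<in> L_E. \<forall>p\<in>P. opnrm p (V - T) < e} \<subseteq> U)"
    if "generate_topology_on B U" "T \<in> L_E" for T U
    using that(1)
  proof (induction rule: generate_topology_on.induct)
    case Empty
    show ?case by simp
  next
    case (Int U1 U2)
    show ?case
    proof
      assume "T \<in> U1 \<inter> U2"
      then obtain P1 e1 P2 e2 where 1: "finite P1" "P1 \<subseteq> S_A" "0 < e1" "{V \<in> L_E. \<forall>p\<in>P1. opnrm p (V - T) < e1} \<subseteq> U1"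
        and 2: "finite P2" "P2 \<subseteq> S_A" "0 < e2" "{V \<in> L_E. \<forall>p\<in>P2. opnrm p (V - T) < e2} \<subseteq> U2"
        using Int.IH by blast
      have "{V \<in> L_E. \<forall>p\<in>P1 \<union> P2. opnrm p (V - T) < min e1 e2} \<subseteq> U1 \<inter> U2"
        using 1(4) 2(4) by auto
      then show "\<exists>P e. finite P \<and> P \<subseteq> S_A \<and> 0 < e \<and> {V \<in> L_E. \<forall>p\<in>P. opnrm p (V - T) < e} \<subseteq> U1 \<inter> U2"
        using 1 2 by (intro exI[of _ "P1 \<union> P2"] exI[of _ "min e1 e2"]) auto
    qed
  next
    case (UN C)
    show ?case
    proof
      assume "T \<in> \<Union> C"
      then obtain U where U: "U \<in> C" "T \<in> U" by blast
      have "\<exists>P e. finite P \<and> P \<subseteq> S_A \<and> 0 < e \<and> {V \<in> L_E. \<forall>p\<in>P. opnrm p (V - T) < e} \<subseteq> U"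
        by (rule UN.IH[OF U(1), rule_format, OF U(2)])
      then obtain P e where "finite P" "P \<subseteq> S_A" "0 < e" "{V \<in> L_E. \<forall>p\<in>P. opnrm p (V - T) < e} \<subseteq> U"
        by (elim exE conjE)
      then show "\<exists>P e. finite P \<and> P \<subseteq> S_A \<and> 0 < e \<and> {V \<in> L_E. \<forall>p\<in>P. opnrm p (V - T) < e} \<subseteq> \<Union> C"
        using U(1) by blast
    qed
  next
    case (Basis U)
    then obtain p W \<epsilon> where U: "U = {V \<in> L_E. opnrm p (V - W) < \<epsilon>}" "p \<in> S_A" "W \<in> L_E" "0 < \<epsilon>"
      unfolding B_def by blast
    show ?case
    proof
      assume "T \<in> U"
      then have less: "opnrm p (T - W) < \<epsilon>" by (simp add: U(1))
      have "opnrm p (V - W) < \<epsilon>" if "V \<in> L_E" "opnrm p (V - T) < \<epsilon> - opnrm p (T - W)" for V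
        using opnrm_add_le[OF diff_in_L[OF that(1) \<open>T \<in> L_E\<close>] diff_in_L[OF \<open>T \<in> L_E\<close> U(3)] U(2)] that(2)
        by simp
      then show "\<exists>P e. finite P \<and> P \<subseteq> S_A \<and> 0 < e \<and> {V \<in> L_E. \<forall>p\<in>P. opnrm p (V - T) < e} \<subseteq> U"
        using less U by (intro exI[of _ "{p}"] exI[of _ "\<epsilon> - opnrm p (T - W)"]) auto
    qed
  qed
  show ?thesis
  proof
    assume "T \<in> K_E"
    then have T: "T \<in> L_E" and meets: "\<And>U. T \<in> U \<and> openin X U \<Longrightarrow> \<exists>V. V \<in> K0 \<and> V \<in> U"
      by (simp_all only: K in_closure_of top)
    have "\<exists>V\<in>K0. \<forall>p\<in>P. opnrm p (V - T) < e" if P: "finite P" "P \<subseteq> S_A" "0 < e" for P e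
    proof -
      let ?U = "(\<Inter>p\<in>P. {U \<in> L_E. opnrm p (U - T) < e}) \<inter> topspace X"
      have "openin X ?U"
        using P T by (intro openin_INT ball) auto
      moreover have "T \<in> ?U" using T P opnrm_0 unfolding top by auto
      ultimately obtain V where "V \<in> K0" "V \<in> ?U" using meets[of ?U] by auto
      then show ?thesis by blast
    qed
    then show "T \<in> L_E \<and> (\<forall>P e. finite P \<and> P \<subseteq> S_A \<and> 0 < e \<longrightarrow> (\<exists>V\<in>K0. \<forall>p\<in>P. opnrm p (V - T) < e))"
      using T by blast
  next
    assume R: "T \<in> L_E \<and> (\<forall>P e. finite P \<and> P \<subseteq> S_A \<and> 0 < e \<longrightarrow> (\<exists>V\<in>K0. \<forall>p\<in>P. opnrm p (V - T) < e))"
    have "\<exists>V. V \<in> K0 \<and> V \<in> U" if "T \<in> U" "openin X U" for U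
    proof -
      have gen: "generate_topology_on B U"
        using that(2) unfolding X_def openin_topology_generated_by_iff .
      have "\<exists>P e. finite P \<and> P \<subseteq> S_A \<and> 0 < e \<and> {V \<in> L_E. \<forall>p\<in>P. opnrm p (V - T) < e} \<subseteq> U"
        by (rule mp[OF nbhd that(1)]) (use gen R in simp_all)
      then obtain P e where P: "finite P" "P \<subseteq> S_A" "0 < e" "{V \<in> L_E. \<forall>p\<in>P. opnrm p (V - T) < e} \<subseteq> U"
        by (elim exE conjE)
      obtain V where "V \<in> K0" "\<forall>p\<in>P. opnrm p (V - T) < e"
        using R P(1-3) by meson
      then show ?thesis using P(4) K0_sub_L by blast
    qed
    then show "T \<in> K_E" unfolding K in_closure_of top using R by simp
  qed
qed

lemma K_sub_L: "T \<in> K_E \<Longrightarrow> T \<in> L_E"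
  by (simp add: K_iff)

lemma K_closed:
  assumes "T \<in> L_E"
    and approx: "\<And>P e. finite P \<Longrightarrow> P \<subseteq> S_A \<Longrightarrow> 0 < e \<Longrightarrow> \<exists>V\<in>K_E. \<forall>p\<in>P. opnrm p (V - T) < e"
  shows "T \<in> K_E"
  unfolding K_iff
proof (intro conjI allI impI)
  fix P and e :: real assume P: "finite P \<and> P \<subseteq> S_A \<and> 0 < e"
  then obtain V where V: "V \<in> K_E" "\<And>p. p \<in> P \<Longrightarrow> opnrm p (V - T) < e / 2"
    using approx[of P "e / 2"] by auto
  then obtain W where W: "W \<in> K0" "\<And>p. p \<in> P \<Longrightarrow> opnrm p (W - V) < e / 2"
    using P unfolding K_iff[of V] by (meson half_gt_zero)
  have "opnrm p (W - T) < e" if "p \<in> P" for p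
  proof -
    have "opnrm p ((W - V) + (V - T)) \<le> opnrm p (W - V) + opnrm p (V - T)"
      using P that W(1) K0_sub_L K_sub_L[OF V(1)] assms(1) by (intro opnrm_add_le diff_in_L) auto
    then show ?thesis using V(2)[OF that] W(2)[OF that] by simp
  qed
  then show "\<exists>V\<in>K0. \<forall>p\<in>P. opnrm p (V - T) < e" using W(1) by blast
qed (rule assms(1))

lemma K0_sub_K: "V \<in> K0 \<Longrightarrow> V \<in> K_E"
proof -
  assume V: "V \<in> K0"
  have "opnrm p (V - V) < e" if "p \<in> S_A" "0 < e" for p e
    using opnrm_le[OF that(1), of 0 0] that by (simp add: nrm_zero)
  then show "V \<in> K_E" unfolding K_iff using V K0_sub_L by blast
qed

lemma K_add:
  assumes "T \<in> K_E" "U \<in> K_E"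
  shows "T + U \<in> K_E"
proof (rule K_closed)
  show "T + U \<in> L_E" using assms by (intro add_in_L K_sub_L)
  fix P and e :: real assume P: "finite P" "P \<subseteq> S_A" "0 < e"
  obtain V where V: "V \<in> K0" "\<And>p. p \<in> P \<Longrightarrow> opnrm p (V - T) < e / 2"
    using P assms(1) unfolding K_iff by (meson half_gt_zero)
  obtain W where W: "W \<in> K0" "\<And>p. p \<in> P \<Longrightarrow> opnrm p (W - U) < e / 2"
    using P assms(2) unfolding K_iff by (meson half_gt_zero)
  have "opnrm p ((V + W) - (T + U)) < e" if "p \<in> P" for p
  proof -
    have "opnrm p ((V - T) + (W - U)) \<le> opnrm p (V - T) + opnrm p (W - U)"
      using P that V(1) W(1) K0_sub_L assms K_sub_L by (intro opnrm_add_le diff_in_L) auto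
    moreover have "(V - T) + (W - U) = (V + W) - (T + U)" by simp
    ultimately show ?thesis using V(2)[OF that] W(2)[OF that] by simp
  qed
  moreover have "V + W \<in> K_E" using V W by (intro K0_sub_K F.span_add)
  ultimately show "\<exists>V\<in>K_E. \<forall>p\<in>P. opnrm p (V - (T + U)) < e" by blast
qed

text \<open>Maps that are Lipschitz for every operator seminorm and preserve the span of the rank one
  operators preserve its closure.\<close>

lemma K_image:
  assumes L: "\<And>V. V \<in> L_E \<Longrightarrow> \<Phi> V \<in> L_E"
    and K0: "\<And>V. V \<in> K0 \<Longrightarrow> \<Phi> V \<in> K0"
    and lip: "\<And>p V W. p \<in> S_A \<Longrightarrow> V \<in> L_E \<Longrightarrow> W \<in> L_E \<Longrightarrow> opnrm p (\<Phi> V - \<Phi> W) \<le> C p * opnrm p (V - W)"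
    and T: "T \<in> K_E"
  shows "\<Phi> T \<in> K_E"
proof (rule K_closed)
  have TL: "T \<in> L_E" using T by (rule K_sub_L)
  then show "\<Phi> T \<in> L_E" by (rule L)
  fix P and e :: real assume P: "finite P" "P \<subseteq> S_A" "0 < e"
  define B where "B = 1 + (\<Sum>p\<in>P. \<bar>C p\<bar>)"
  have "B > 0" unfolding B_def by (simp add: add_pos_nonneg sum_nonneg)
  then obtain V where V: "V \<in> K0" "\<And>p. p \<in> P \<Longrightarrow> opnrm p (V - T) < e / B"
    using P T unfolding K_iff by (meson divide_pos_pos)
  have "opnrm p (\<Phi> V - \<Phi> T) < e" if "p \<in> P" for p
  proof -
    have p: "p \<in> S_A" using that P by blast
    have VL: "V \<in> L_E" using V(1) K0_sub_L by blast
    have "\<bar>C p\<bar> \<le> (\<Sum>p\<in>P. \<bar>C p\<bar>)" using that P(1) by (intro member_le_sum) auto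
    then have "C p \<le> B" unfolding B_def by linarith
    then have "C p * opnrm p (V - T) \<le> B * opnrm p (V - T)"
      using opnrm_nonneg[OF diff_in_L[OF VL TL] p] by (intro mult_right_mono)
    also have "\<dots> < e" using V(2)[OF that] \<open>B > 0\<close> by (simp add: field_simps)
    finally show ?thesis using lip[OF p VL TL] by linarith
  qed
  then show "\<exists>V\<in>K_E. \<forall>p\<in>P. opnrm p (V - \<Phi> T) < e" using K0 K0_sub_K V(1) by blast
qed

lemma K_scale: "T \<in> K_E \<Longrightarrow> scale_map scaleE c T \<in> K_E"
proof (rule K_image[where \<Phi> = "scale_map scaleE c" and C = "\<lambda>_. cmod c"])
  show "opnrm p (scale_map scaleE c V - scale_map scaleE c W) \<le> cmod c * opnrm p (V - W)"
    if "p \<in> S_A" "V \<in> L_E" "W \<in> L_E" for p V W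
    using opnrm_scale_le[OF diff_in_L[OF that(2,3)] that(1), of c] by (simp add: F.scale_right_diff_distrib)
qed (auto intro: scale_in_L F.span_scale)

lemma K_comp_left:
  assumes U: "U \<in> L_E" and "T \<in> K_E"
  shows "U \<circ> T \<in> K_E"
  using assms(2)
proof (rule K_image[where \<Phi> = "\<lambda>T. U \<circ> T" and C = "\<lambda>p. opnrm p U", rotated -1])
  show "U \<circ> V \<in> L_E" if "V \<in> L_E" for V using U that by (rule comp_in_L)
  show "U \<circ> V \<in> K0" if "V \<in> K0" for V
    using that
  proof (induction rule: F.span_induct_alt)
    case base
    have "U \<circ> 0 = (0 :: 'e \<Rightarrow> 'e)" using L_D(2)[OF U, of 0 0] by (simp add: fun_eq_iff)
    then show ?case by (simp only: F.span_zero)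
  next
    case (step c V W)
    then obtain x y where V: "V = rank_one act ip x y" by blast
    have "U \<circ> V = rank_one act ip (U x) y"
      by (simp add: V fun_eq_iff rank_one_def L_D[OF U])
    then have "U \<circ> V \<in> K0" by (auto intro: F.span_base)
    moreover have "U \<circ> (scale_map scaleE c V + W) = scale_map scaleE c (U \<circ> V) + (U \<circ> W)"
      by (simp add: fun_eq_iff scale_map_def L_D[OF U])
    ultimately show ?case using step by (simp only: F.span_add F.span_scale)
  qed
  show "opnrm p ((U \<circ> V) - (U \<circ> W)) \<le> opnrm p U * opnrm p (V - W)"
    if "p \<in> S_A" "V \<in> L_E" "W \<in> L_E" for p V W
  proof -
    have "(U \<circ> V) - (U \<circ> W) = U \<circ> (V - W)" by (simp add: fun_eq_iff L_diff_arg[OF U])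
    then show ?thesis using opnrm_comp_le[OF U diff_in_L[OF that(2,3)] that(1)] by simp
  qed
qed

lemma K_comp_right:
  assumes U: "U \<in> L_E" and "T \<in> K_E"
  shows "T \<circ> U \<in> K_E"
  using assms(2)
proof (rule K_image[where \<Phi> = "\<lambda>T. T \<circ> U" and C = "\<lambda>p. opnrm p U", rotated -1])
  show "V \<circ> U \<in> L_E" if "V \<in> L_E" for V using that U by (rule comp_in_L)
  show "V \<circ> U \<in> K0" if "V \<in> K0" for V
    using that
  proof (induction rule: F.span_induct_alt)
    case base
    have "0 \<circ> U = (0 :: 'e \<Rightarrow> 'e)" by (simp add: fun_eq_iff)
    then show ?case by (simp only: F.span_zero)
  next
    case (step c V W)
    then obtain x y where V: "V = rank_one act ip x y" by blast
    have "V \<circ> U = rank_one act ip x (adj U y)"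
      by (simp add: V fun_eq_iff rank_one_def adj_right[OF U])
    then have "V \<circ> U \<in> K0" by (auto intro: F.span_base)
    moreover have "(scale_map scaleE c V + W) \<circ> U = scale_map scaleE c (V \<circ> U) + (W \<circ> U)"
      by (simp add: fun_eq_iff scale_map_def)
    ultimately show ?case using step by (simp only: F.span_add F.span_scale)
  qed
  show "opnrm p ((V \<circ> U) - (W \<circ> U)) \<le> opnrm p U * opnrm p (V - W)"
    if "p \<in> S_A" "V \<in> L_E" "W \<in> L_E" for p V W
  proof -
    have "(V \<circ> U) - (W \<circ> U) = (V - W) \<circ> U" by (simp add: fun_eq_iff)
    then show ?thesis using opnrm_comp_le[OF diff_in_L[OF that(2,3)] U that(1)] by (simp add: mult.commute)
  qed
qed

lemma K_adj: "T \<in> K_E \<Longrightarrow> adj T \<in> K_E"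
proof (rule K_image[where \<Phi> = adj and C = "\<lambda>_. 1", rotated -1])
  have "V \<in> L_E \<and> adj V \<in> K0" if "V \<in> K0" for V
    using that
  proof (induction rule: F.span_induct_alt)
    case base
    have "ip 0 x = 0" "ip x 0 = 0" for x
      using ip_scale_left[of 0 0 x] ip_scale_right[of x 0 0] by simp_all
    then have "adj 0 = 0" by (intro adj_eqI zero_in_L) simp
    then show ?case by (simp only: F.span_zero zero_in_L)
  next
    case (step c V W)
    then obtain x y where V: "V = rank_one act ip x y" by blast
    have W: "W \<in> L_E" using step by blast
    moreover have "scale_map scaleE c V + W \<in> L_E"
      unfolding V by (intro add_in_L scale_in_L rank_one_in_L W)
    moreover have "adj (scale_map scaleE c V + W) = scale_map scaleE (cnj c) (rank_one act ip y x) + adj W"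
      using W by (intro adj_eqI add_in_L scale_in_L)
        (auto simp: V rank_one_in_L scale_map_def ip_add_left ip_add_right ip_scale_left ip_scale_right rank_one_adj adj_left)
    moreover have "rank_one act ip y x \<in> K0" by (auto intro: F.span_base)
    ultimately show ?case using step by (simp only: F.span_add F.span_scale)
  qed
  then show "adj V \<in> K0" if "V \<in> K0" for V using that by blast
  show "opnrm p (adj V - adj W) \<le> 1 * opnrm p (V - W)"
    if "p \<in> S_A" "V \<in> L_E" "W \<in> L_E" for p V W
  proof -
    have "adj (V - W) = adj V - adj W"
      using that by (intro adj_eqI diff_in_L) (auto simp: ip_diff_left ip_diff_right adj_left)
    then show ?thesis using opnrm_adj_le[OF diff_in_L[OF that(2,3)] that(1)] by simp
  qed
qed (auto intro: adj_in_L)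

section \<open>Cube roots of compact operators\<close>

lemma poly_op_in_K:
  assumes h: "h \<in> K_E" and f: "coeff f 0 = 0"
  shows "poly_op scaleE h f \<in> K_E"
proof -
  interpret h: linear_operator scaleE h
    using L_D[OF K_sub_L[OF h]] by unfold_locales auto
  have L: "poly_op scaleE h g \<in> L_E" for g
  proof (induction g)
    case 0
    have "poly_op scaleE h 0 = (0 :: 'e \<Rightarrow> 'e)" by (simp add: fun_eq_iff)
    then show ?case using zero_in_L by (simp only:)
  next
    case (pCons a g)
    have id: "id \<in> L_E"
      by (rule L_I[of _ id]) (auto intro: exI[of _ 1])
    have "poly_op scaleE h (pCons a g) = scale_map scaleE (complex_of_real a) id + (h \<circ> poly_op scaleE h g)"
      by (simp add: fun_eq_iff scale_map_def)
    then show ?case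
      using add_in_L[OF scale_in_L[OF id] comp_in_L[OF K_sub_L[OF h] pCons.IH]] by (simp only:)
  qed
  obtain a g where "f = pCons a g" by (cases f)
  then have "f = pCons 0 g" using f by simp
  then have "poly_op scaleE h f = h \<circ> poly_op scaleE h g" by (simp add: fun_eq_iff)
  then show ?thesis using K_comp_right[OF L h] by (simp only:)
qed

text \<open>
  For one real sequence of polynomials that converges uniformly on compact sets, the polynomials
  of \<open>h\<close> converge for all seminorms. As \<open>root 3 t\<close> is real and continuous on the whole line, no
  decomposition into positive parts is needed. Polynomials without constant term stay in \<open>K_E\<close>.
\<close>

theorem compact_cube_root:
  assumes h: "h \<in> K_E" and sa: "\<And>x y. ip (h x) y = ip x (h y)"
  obtains a where "a \<in> K_E" "h = a \<circ> (a \<circ> a)"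
proof -
  have hL: "h \<in> L_E" using h by (rule K_sub_L)
  interpret h: linear_operator scaleE h
    using L_D[OF hL] by unfold_locales auto
  have "\<exists>P. poly P 0 = 0 \<and> (\<forall>t\<in>{- real n..real n}. \<bar>poly P t - root 3 t\<bar> \<le> 1 / real (Suc n))" for n
  proof -
    have "continuous_on {- real n..real n} (root 3)"
      using continuous_on_real_root[OF continuous_on_id] by simp
    then obtain P where P: "\<forall>t\<in>{- real n..real n}. \<bar>poly P t - root 3 t\<bar> < 1 / (2 * real (Suc n))"
      using Weierstrass_poly[of "- real n" "real n" "root 3" "1 / (2 * real (Suc n))"] by auto
    \<comment> \<open>As \<open>root 3 0 = 0\<close>, removing the constant term at most doubles the error.\<close>
    have "\<bar>poly (P - [:poly P 0:]) t - root 3 t\<bar> \<le> 1 / real (Suc n)" if "t \<in> {- real n..real n}" for t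
    proof -
      have "1 / (2 * real (Suc n)) + 1 / (2 * real (Suc n)) = 1 / real (Suc n)" by (simp add: field_simps)
      then show ?thesis using bspec[OF P that] bspec[OF P, of 0] by (simp add: abs_le_iff abs_less_iff)
    qed
    then show ?thesis by (intro exI[of _ "P - [:poly P 0:]"]) simp
  qed
  then obtain P where P0: "\<And>n. poly (P n) 0 = 0"
    and P: "\<And>n t. t \<in> {- real n..real n} \<Longrightarrow> \<bar>poly (P n) t - root 3 t\<bar> \<le> 1 / real (Suc n)"
    by metis
  define Q where "Q n = poly_op scaleE h (P n)" for n
  have Q: "Q n \<in> K_E" for n
    unfolding Q_def by (rule poly_op_in_K[OF h]) (simp add: poly_0_coeff_0[symmetric] P0)
  have Q_sa: "ip (Q n x) y = ip x (Q n y)" for n x y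
  proof -
    have "ip 0 y = 0" "ip y 0 = 0" for y
      using ip_scale_left[of 0 0 y] ip_scale_right[of y 0 0] by simp_all
    then have "ip (poly_op scaleE h f x) y = ip x (poly_op scaleE h f y)" for f
      by (induction f arbitrary: x y)
         (simp_all add: ip_add_left ip_add_right ip_scale_left ip_scale_right sa h.poly_op_commute[symmetric])
    then show ?thesis by (simp only: Q_def)
  qed
  have spectral: "\<exists>N C. 0 \<le> C \<and>
      (\<forall>n m x. N \<le> n \<and> n \<le> m \<longrightarrow> nrm p (Q n x - Q m x) \<le> 2 / real (Suc n) * nrm p x) \<and>
      (\<forall>n x. N \<le> n \<longrightarrow> nrm p (Q n (Q n (Q n x)) - h x) \<le> C / real (Suc n) * nrm p x)"
    if p: "p \<in> S_A" for p
  proof -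
    interpret P: cauchy_schwarz_module scaleA star scaleE ip p by (rule module_S[OF p])
    obtain \<sigma> where \<sigma>: "compact \<sigma>"
      "\<And>f C. 0 \<le> C \<Longrightarrow> (\<forall>x. nrm p (poly_op scaleE h f x) \<le> C * nrm p x) \<longleftrightarrow> (\<forall>t\<in>\<sigma>. \<bar>poly f t\<bar> \<le> C)"
      using P.spectrum_selfadjoint[of h "opnrm p h"] L_D[OF hL] sa nrm_le[OF hL p] by metis
    obtain B where B: "\<And>t. t \<in> \<sigma> \<Longrightarrow> \<bar>t\<bar> \<le> B" "B > 0"
      using compact_imp_bounded[OF \<sigma>(1)] by (auto simp: bounded_pos)
    obtain N where N: "B \<le> real N" using real_arch_simple by blast
    have near: "\<bar>poly (P n) t - root 3 t\<bar> \<le> 1 / real (Suc n)" if "t \<in> \<sigma>" "N \<le> n" for n t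
    proof (rule P)
      have "\<bar>t\<bar> \<le> B" "real N \<le> real n" using B(1) that by auto
      then have "\<bar>t\<bar> \<le> real n" using N by linarith
      then show "t \<in> {- real n..real n}" by auto
    qed
    have "nrm p (Q n x - Q m x) \<le> 2 / real (Suc n) * nrm p x" if "N \<le> n" "n \<le> m" for n m x
    proof -
      have "\<bar>poly (P n - P m) t\<bar> \<le> 2 / real (Suc n)" if "t \<in> \<sigma>" for t
      proof -
        have "1 / real (Suc m) \<le> 1 / real (Suc n)" using \<open>n \<le> m\<close> by (intro divide_left_mono) auto
        then show ?thesis
          using near[OF that \<open>N \<le> n\<close>] near[OF that, of m] \<open>N \<le> n\<close> \<open>n \<le> m\<close> by (simp add: abs_le_iff)
      qed
      then show ?thesis using \<sigma>(2)[of "2 / real (Suc n)" "P n - P m"] by (simp add: h.poly_op_diff Q_def)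
    qed
    moreover define D where "D = root 3 B + 1"
    have "D \<ge> 1" using B(2) by (simp add: D_def)
    have "nrm p (Q n (Q n (Q n x)) - h x) \<le> (3 * D\<^sup>2) / real (Suc n) * nrm p x" if "N \<le> n" for n x
    proof -
      let ?f = "P n * (P n * P n) - [:0, 1:]"
      have "\<bar>poly ?f t\<bar> \<le> (3 * D\<^sup>2) / real (Suc n)" if "t \<in> \<sigma>" for t
      proof -
        let ?u = "poly (P n) t" and ?v = "root 3 t"
        have v: "\<bar>?v\<bar> \<le> D"
          using real_root_le_mono[of 3 "\<bar>t\<bar>" B] B(1)[OF that] by (simp add: D_def real_root_abs)
        have uv: "\<bar>?u - ?v\<bar> \<le> 1 / real (Suc n)" by (rule near[OF that \<open>N \<le> n\<close>])
        moreover have "1 / real (Suc n) \<le> 1" by simp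
        moreover have "\<bar>?v\<bar> \<le> D - 1"
          using real_root_le_mono[of 3 "\<bar>t\<bar>" B] B(1)[OF that] by (simp add: D_def real_root_abs)
        ultimately have u: "\<bar>?u\<bar> \<le> D" by linarith
        have "poly ?f t = ?u * (?u * ?u) - ?v ^ 3" by (simp add: odd_real_root_pow)
        also have "\<dots> = (?u - ?v) * (?u * ?u + ?u * ?v + ?v * ?v)"
          by (simp add: power3_eq_cube algebra_simps)
        finally have "\<bar>poly ?f t\<bar> = \<bar>?u - ?v\<bar> * \<bar>?u * ?u + ?u * ?v + ?v * ?v\<bar>"
          by (simp only: abs_mult)
        also have "\<dots> \<le> 1 / real (Suc n) * (D * D + D * D + D * D)"
        proof (intro mult_mono uv)
          have "\<bar>?u * ?u\<bar> \<le> D * D" "\<bar>?u * ?v\<bar> \<le> D * D" "\<bar>?v * ?v\<bar> \<le> D * D"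
            unfolding abs_mult using \<open>D \<ge> 1\<close> by (intro mult_mono u v abs_ge_zero; simp)+
          then show "\<bar>?u * ?u + ?u * ?v + ?v * ?v\<bar> \<le> D * D + D * D + D * D" by linarith
        qed auto
        finally show ?thesis by (simp add: power2_eq_square)
      qed
      then have "nrm p (poly_op scaleE h ?f x) \<le> (3 * D\<^sup>2) / real (Suc n) * nrm p x"
        using \<sigma>(2)[of "(3 * D\<^sup>2) / real (Suc n)" ?f] by simp
      moreover have "poly_op scaleE h ?f x = Q n (Q n (Q n x)) - h x"
        by (simp add: h.poly_op_diff h.poly_op_mult Q_def h.T_zero)
      ultimately show ?thesis by simp
    qed
    ultimately show ?thesis by (intro exI[of _ N] exI[of _ "3 * D\<^sup>2"]) auto
  qed
  have inverse_small: "\<exists>M. \<forall>n\<ge>M. C / real (Suc n) < e" if "e > 0" for C e :: real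
  proof -
    have "(\<lambda>n. C / real (Suc n)) \<longlonglongrightarrow> 0"
      by (rule LIMSEQ_Suc[OF lim_const_over_n])
    then show ?thesis
      using order_tendstoD(2)[of _ 0 sequentially e] that by (auto simp: eventually_sequentially)
  qed
  have "\<exists>y. \<forall>p\<in>S_A. (\<lambda>n. nrm p (Q n x - y)) \<longlonglongrightarrow> 0" for x
  proof -
    let ?F = "filtermap (\<lambda>n. Q n x) sequentially"
    have "((\<lambda>(u, v). nrm p (u - v)) \<longlongrightarrow> 0) (?F \<times>\<^sub>F ?F)" if p: "p \<in> S_A" for p
    proof (rule tendstoI)
      fix e :: real assume "e > 0"
      obtain N where N: "\<And>n m. N \<le> n \<Longrightarrow> n \<le> m \<Longrightarrow> nrm p (Q n x - Q m x) \<le> 2 / real (Suc n) * nrm p x"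
        using spectral[OF p] by blast
      obtain M where M: "\<And>n. n \<ge> M \<Longrightarrow> 2 * nrm p x / real (Suc n) < e"
        using inverse_small[OF \<open>e > 0\<close>] by blast
      have less: "nrm p (Q n x - Q m x) < e" if "max N M \<le> n" "max N M \<le> m" for n m
      proof (cases "n \<le> m")
        case True
        then show ?thesis using N[of n m] M[of n] that by simp
      next
        case False
        then have "nrm p (- (Q n x - Q m x)) < e" using N[of m n] M[of m] that by simp
        then show ?thesis by (simp only: nrm_minus[OF p])
      qed
      define R where "R u \<longleftrightarrow> (\<exists>n\<ge>max N M. u = Q n x)" for u
      have "eventually R ?F"
        unfolding eventually_filtermap eventually_sequentially R_def by blast
      moreover have "dist (case (u, v) of (u, v) \<Rightarrow> nrm p (u - v)) 0 < e" if "R u" "R v" for u v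
        using that less nrm_nonneg[OF p] by (auto simp: R_def dist_real_def)
      ultimately show "eventually (\<lambda>w. dist (case w of (u, v) \<Rightarrow> nrm p (u - v)) 0 < e) (?F \<times>\<^sub>F ?F)"
        unfolding eventually_prod_filter by blast
    qed
    then have cauchy: "\<forall>q\<in>nrm ` S_A. ((\<lambda>(u, v). q (u - v)) \<longlongrightarrow> 0) (?F \<times>\<^sub>F ?F)"
      by blast
    have "?F \<noteq> bot" by (simp add: filtermap_bot_iff)
    then obtain y where "\<forall>q\<in>nrm ` S_A. ((\<lambda>u. q (u - y)) \<longlongrightarrow> 0) ?F"
      using complete_E cauchy unfolding seminorms_complete_def by blast
    then have "\<forall>p\<in>S_A. (\<lambda>n. nrm p (Q n x - y)) \<longlonglongrightarrow> 0"
      by (simp add: filterlim_filtermap)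
    then show ?thesis by blast
  qed
  then obtain a where a: "\<And>x p. p \<in> S_A \<Longrightarrow> (\<lambda>n. nrm p (Q n x - a x)) \<longlonglongrightarrow> 0"
    by metis
  have near: "\<exists>N. \<forall>n\<ge>N. \<forall>x. nrm p (Q n x - a x) \<le> 2 / real (Suc n) * nrm p x" if p: "p \<in> S_A" for p
  proof -
    obtain N where N: "\<And>n m x. N \<le> n \<Longrightarrow> n \<le> m \<Longrightarrow> nrm p (Q n x - Q m x) \<le> 2 / real (Suc n) * nrm p x"
      using spectral[OF p] by blast
    have "nrm p (Q n x - a x) \<le> 2 / real (Suc n) * nrm p x" if "N \<le> n" for n x
    proof (rule tendsto_lowerbound)
      have "(\<lambda>m. 2 / real (Suc n) * nrm p x + nrm p (Q m x - a x)) \<longlonglongrightarrow> 2 / real (Suc n) * nrm p x + 0"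
        by (intro tendsto_intros a[OF p])
      then show "(\<lambda>m. 2 / real (Suc n) * nrm p x + nrm p (Q m x - a x)) \<longlonglongrightarrow> 2 / real (Suc n) * nrm p x"
        by simp
      show "eventually (\<lambda>m. nrm p (Q n x - a x) \<le> 2 / real (Suc n) * nrm p x + nrm p (Q m x - a x)) sequentially"
        unfolding eventually_sequentially
      proof (intro exI[of _ n] allI impI)
        fix m assume "n \<le> m"
        have "nrm p ((Q n x - Q m x) + (Q m x - a x)) \<le> nrm p (Q n x - Q m x) + nrm p (Q m x - a x)"
          by (rule nrm_add[OF p])
        then show "nrm p (Q n x - a x) \<le> 2 / real (Suc n) * nrm p x + nrm p (Q m x - a x)"
          using N[OF \<open>N \<le> n\<close> \<open>n \<le> m\<close>, of x] by simp
      qed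
    qed simp
    then show ?thesis by blast
  qed
  have a_sa: "ip (a x) y = ip x (a y)" for x y
  proof -
    have "p (ip (a x) y - ip x (a y)) = 0" if p: "p \<in> S_A" for p
    proof -
      interpret P: cauchy_schwarz_module scaleA star scaleE ip p by (rule module_S[OF p])
      have le: "p (ip (a x) y - ip x (a y)) \<le> nrm p (Q n x - a x) * nrm p y + nrm p x * nrm p (Q n y - a y)" for n
      proof -
        have "ip (a x) y - ip x (a y) = ip (a x - Q n x) y + ip x (Q n y - a y)"
          by (simp add: ip_diff_left ip_diff_right Q_sa)
        then have "p (ip (a x) y - ip x (a y)) \<le> p (ip (a x - Q n x) y) + p (ip x (Q n y - a y))"
          using P.p_add by metis
        also have "\<dots> \<le> nrm p (a x - Q n x) * nrm p y + nrm p x * nrm p (Q n y - a y)"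
          by (intro add_mono p_ip_le[OF p])
        also have "nrm p (a x - Q n x) = nrm p (Q n x - a x)"
          using nrm_minus[OF p, of "a x - Q n x"] by simp
        finally show ?thesis .
      qed
      have "(\<lambda>n. nrm p (Q n x - a x) * nrm p y + nrm p x * nrm p (Q n y - a y)) \<longlonglongrightarrow> 0 * nrm p y + nrm p x * 0"
        by (intro tendsto_intros a[OF p])
      then have "(\<lambda>n. nrm p (Q n x - a x) * nrm p y + nrm p x * nrm p (Q n y - a y)) \<longlonglongrightarrow> 0"
        by simp
      then have "p (ip (a x) y - ip x (a y)) \<le> 0"
        by (rule tendsto_lowerbound) (simp_all add: le)
      then show ?thesis using P.p_nonneg[of "ip (a x) y - ip x (a y)"] by linarith
    qed
    then show ?thesis using seminorms_separate[of "ip (a x) y - ip x (a y)"] by simp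
  qed
  have aL: "a \<in> L_E"
  proof (rule L_I[of _ a])
    fix p assume p: "p \<in> S_A"
    obtain N where N: "\<And>x. nrm p (Q N x - a x) \<le> 2 / real (Suc N) * nrm p x"
      using near[OF p] by blast
    have "nrm p (a x) \<le> (opnrm p (Q N) + 2 / real (Suc N)) * nrm p x" for x
    proof -
      have "nrm p (Q N x - (Q N x - a x)) \<le> nrm p (Q N x) + nrm p (Q N x - a x)"
        by (rule nrm_diff[OF p])
      also have "\<dots> \<le> opnrm p (Q N) * nrm p x + 2 / real (Suc N) * nrm p x"
        by (intro add_mono nrm_le K_sub_L Q p N)
      finally show ?thesis by (simp add: distrib_right)
    qed
    then show "\<exists>M. \<forall>x. nrm p (a x) \<le> M * nrm p x" by blast
  qed (rule a_sa)
  have opnear: "\<exists>N. \<forall>n\<ge>N. opnrm p (Q n - a) \<le> 2 / real (Suc n)" if p: "p \<in> S_A" for p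
  proof -
    obtain N where N: "\<And>n x. n \<ge> N \<Longrightarrow> nrm p (Q n x - a x) \<le> 2 / real (Suc n) * nrm p x"
      using near[OF p] by blast
    have "opnrm p (Q n - a) \<le> 2 / real (Suc n)" if "n \<ge> N" for n
      using N[OF that] by (intro opnrm_le[OF p]) auto
    then show ?thesis by blast
  qed
  have "a \<in> K_E"
  proof (rule K_closed[OF aL])
    fix S and e :: real assume S: "finite S" "S \<subseteq> S_A" "0 < e"
    obtain M where M: "\<And>n. n \<ge> M \<Longrightarrow> 2 / real (Suc n) < e"
      using inverse_small[OF \<open>0 < e\<close>] by blast
    have "\<forall>p\<in>S. eventually (\<lambda>n. opnrm p (Q n - a) < e) sequentially"
    proof
      fix p assume "p \<in> S"
      then obtain N where N: "\<And>n. n \<ge> N \<Longrightarrow> opnrm p (Q n - a) \<le> 2 / real (Suc n)"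
        using opnear S(2) by blast
      have "opnrm p (Q n - a) < e" if "n \<ge> max N M" for n
        using N[of n] M[of n] that by simp
      then show "eventually (\<lambda>n. opnrm p (Q n - a) < e) sequentially"
        unfolding eventually_sequentially by blast
    qed
    then have "eventually (\<lambda>n. \<forall>p\<in>S. opnrm p (Q n - a) < e) sequentially"
      using S(1) by (simp add: eventually_ball_finite)
    then obtain n where "\<forall>p\<in>S. opnrm p (Q n - a) < e"
      unfolding eventually_sequentially by blast
    then show "\<exists>V\<in>K_E. \<forall>p\<in>S. opnrm p (V - a) < e" using Q by blast
  qed
  moreover have "h = a \<circ> (a \<circ> a)"
  proof
    fix x
    have "nrm p (h x - a (a (a x))) = 0" if p: "p \<in> S_A" for p
    proof -
      obtain N C where N: "0 \<le> C" "\<And>n x. N \<le> n \<Longrightarrow> nrm p (Q n (Q n (Q n x)) - h x) \<le> C / real (Suc n) * nrm p x"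
        using spectral[OF p] by blast
      obtain N' where N': "\<And>n. N' \<le> n \<Longrightarrow> opnrm p (Q n - a) \<le> 2 / real (Suc n)"
        using opnear[OF p] by blast
      define A where "A = opnrm p a + 2"
      have A: "opnrm p a \<le> A" "0 \<le> A" using opnrm_nonneg[OF aL p] by (simp_all add: A_def)
      have QL: "Q n \<in> L_E" for n using Q by (rule K_sub_L)
      have dL: "Q n - a \<in> L_E" for n by (intro diff_in_L QL aL)
      have le: "nrm p (h x - a (a (a x))) \<le> (C * nrm p x + 6 * A\<^sup>2 * nrm p x) / real (Suc n)" if n: "max N N' \<le> n" for n
      proof -
        let ?e = "2 / real (Suc n)"
        let ?d = "Q n - a"
        have d: "opnrm p ?d \<le> ?e" using N' n by simp
        have "opnrm p (?d + a) \<le> opnrm p ?d + opnrm p a" by (rule opnrm_add_le[OF dL aL p])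
        moreover have "?e \<le> 2" by (simp add: divide_le_eq)
        moreover have "?d + a = Q n" by simp
        ultimately have q: "opnrm p (Q n) \<le> A" using d A_def by (metis add.commute add_mono order_trans order_refl)
        have prod: "nrm p (U (V (W x))) \<le> ?e * A\<^sup>2 * nrm p x"
          if "U \<in> L_E" "V \<in> L_E" "W \<in> L_E" "opnrm p U * opnrm p V * opnrm p W \<le> ?e * A\<^sup>2" for U V W
        proof -
          have "nrm p (U (V (W x))) \<le> opnrm p U * (opnrm p V * opnrm p W * nrm p x)"
            using that p by (intro order_trans[OF nrm_le[OF that(1) p]] mult_left_mono nrm_comp_le opnrm_nonneg)
          also have "\<dots> = (opnrm p U * opnrm p V * opnrm p W) * nrm p x" by simp
          also have "\<dots> \<le> (?e * A\<^sup>2) * nrm p x"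
            using that nrm_nonneg[OF p] by (intro mult_right_mono)
          finally show ?thesis .
        qed
        have on: "0 \<le> opnrm p a" "0 \<le> opnrm p ?d" "0 \<le> opnrm p (Q n)"
          by (intro opnrm_nonneg aL dL QL p)+
        have 1: "nrm p (?d (Q n (Q n x))) \<le> ?e * A\<^sup>2 * nrm p x"
        proof (rule prod[OF dL QL QL])
          have "opnrm p ?d * (opnrm p (Q n) * opnrm p (Q n)) \<le> ?e * (A * A)"
            using d q on A(2) by (intro mult_mono) auto
          then show "opnrm p ?d * opnrm p (Q n) * opnrm p (Q n) \<le> ?e * A\<^sup>2"
            by (simp only: mult.assoc power2_eq_square)
        qed
        have 2: "nrm p (a (?d (Q n x))) \<le> ?e * A\<^sup>2 * nrm p x"
        proof (rule prod[OF aL dL QL])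
          have "opnrm p ?d * (opnrm p a * opnrm p (Q n)) \<le> ?e * (A * A)"
            using d q on A by (intro mult_mono) auto
          then show "opnrm p a * opnrm p ?d * opnrm p (Q n) \<le> ?e * A\<^sup>2"
            by (simp only: mult_ac power2_eq_square)
        qed
        have 3: "nrm p (a (a (?d x))) \<le> ?e * A\<^sup>2 * nrm p x"
        proof (rule prod[OF aL aL dL])
          have "opnrm p ?d * (opnrm p a * opnrm p a) \<le> ?e * (A * A)"
            using d on A by (intro mult_mono) auto
          then show "opnrm p a * opnrm p a * opnrm p ?d \<le> ?e * A\<^sup>2"
            by (simp only: mult_ac power2_eq_square)
        qed
        let ?s = "- (Q n (Q n (Q n x)) - h x)"
        let ?t = "?d (Q n (Q n x)) + (a (?d (Q n x)) + a (a (?d x)))"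
        have "h x - a (a (a x)) = ?s + ?t"
          by (simp add: L_diff_arg[OF aL])
        then have "nrm p (h x - a (a (a x))) \<le> nrm p ?s + nrm p ?t"
          using nrm_add[OF p, of ?s ?t] by (simp only:)
        also have "nrm p ?t \<le> nrm p (?d (Q n (Q n x))) + (nrm p (a (?d (Q n x))) + nrm p (a (a (?d x))))"
          by (intro order_trans[OF nrm_add[OF p]] add_left_mono nrm_add[OF p])
        also have "nrm p ?s \<le> C / real (Suc n) * nrm p x"
          using N(2)[of n x] n by (simp only: nrm_minus[OF p])
        finally have "nrm p (h x - a (a (a x))) \<le> C / real (Suc n) * nrm p x + 3 * (?e * A\<^sup>2 * nrm p x)"
          using 1 2 3 by simp
        also have "\<dots> = (C * nrm p x + 6 * A\<^sup>2 * nrm p x) / real (Suc n)"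
          by (simp add: add_divide_distrib)
        finally show ?thesis .
      qed
      have "nrm p (h x - a (a (a x))) \<le> 0"
      proof (rule field_le_epsilon)
        fix e :: real assume "e > 0"
        obtain M where M: "\<And>n. n \<ge> M \<Longrightarrow> (C * nrm p x + 6 * A\<^sup>2 * nrm p x) / real (Suc n) < e"
          using inverse_small[OF \<open>e > 0\<close>] by blast
        define n where "n = max M (max N N')"
        have "nrm p (h x - a (a (a x))) \<le> (C * nrm p x + 6 * A\<^sup>2 * nrm p x) / real (Suc n)"
          by (rule le) (simp add: n_def)
        also have "\<dots> < e" by (rule M) (simp add: n_def)
        finally show "nrm p (h x - a (a (a x))) \<le> 0 + e" by simp
      qed
      then show ?thesis using nrm_nonneg[OF p, of "h x - a (a (a x))"] by linarith
    qed
    then show "h x = (a \<circ> (a \<circ> a)) x" using nrm_separate[of "h x - a (a (a x))"] by simp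
  qed
  ultimately show ?thesis using that by blast
qed

section \<open>Derivations\<close>

lemma derivation_preserves_K:
  assumes D: "derivation_on (scale_map scaleE) (\<circ>) L_E D" and T: "T \<in> K_E"
  shows "D T \<in> K_E"
proof -
  have D_in: "\<And>U. U \<in> L_E \<Longrightarrow> D U \<in> L_E"
    and D_add: "\<And>U V. U \<in> L_E \<Longrightarrow> V \<in> L_E \<Longrightarrow> D (U + V) = D U + D V"
    and D_scale: "\<And>c U. U \<in> L_E \<Longrightarrow> D (scale_map scaleE c U) = scale_map scaleE c (D U)"
    and D_comp: "\<And>U V. U \<in> L_E \<Longrightarrow> V \<in> L_E \<Longrightarrow> D (U \<circ> V) = (D U \<circ> V) + (U \<circ> D V)"
    using D unfolding derivation_on_def by auto
  have selfadjoint: "D h \<in> K_E" if h: "h \<in> K_E" "\<And>x y. ip (h x) y = ip x (h y)" for h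
  proof -
    obtain a where a: "a \<in> K_E" "h = a \<circ> (a \<circ> a)"
      using compact_cube_root[OF h] by blast
    have aL: "a \<in> L_E" and aaL: "a \<circ> a \<in> L_E" and aaK: "a \<circ> a \<in> K_E"
      using a(1) by (auto intro: K_sub_L comp_in_L K_comp_left)
    have "D h = (D a \<circ> (a \<circ> a)) + (a \<circ> D (a \<circ> a))"
      unfolding a(2) by (rule D_comp[OF aL aaL])
    moreover have "(D a \<circ> (a \<circ> a)) + (a \<circ> D (a \<circ> a)) \<in> K_E"
      by (intro K_add K_comp_left K_comp_right D_in aL aaL aaK a(1))
    ultimately show ?thesis by (simp only:)
  qed
  have TL: "T \<in> L_E" using T by (rule K_sub_L)
  \<comment> \<open>Twice the real and the imaginary part of \<open>T\<close>.\<close>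
  define h1 where "h1 = T + adj T"
  define h2 where "h2 = scale_map scaleE \<i> (adj T + scale_map scaleE (-1) T)"
  have h1: "h1 \<in> K_E" unfolding h1_def by (intro K_add K_adj T)
  have h2: "h2 \<in> K_E" unfolding h2_def by (intro K_scale K_add K_adj T)
  have s1: "ip (h1 x) y = ip x (h1 y)" for x y
    by (simp add: h1_def ip_add_left ip_add_right adj_left[OF TL] adj_right[OF TL] add.commute)
  have s2: "ip (h2 x) y = ip x (h2 y)" for x y
    by (simp add: h2_def scale_map_def ip_add_left ip_add_right ip_scale_left ip_scale_right
        ip_diff_left ip_diff_right adj_left[OF TL] adj_right[OF TL] A.scale_right_diff_distrib)
  have "T = scale_map scaleE (1 / 2) (h1 + scale_map scaleE \<i> h2)"
  proof
    fix x
    have "scaleE \<i> (scaleE \<i> u) = - u" for u by simp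
    moreover have "scaleE (1 / 2) (u + u) = u" for u
      by (simp add: E.scale_right_distrib flip: E.scale_left_distrib)
    ultimately show "T x = scale_map scaleE (1 / 2) (h1 + scale_map scaleE \<i> h2) x"
      by (simp add: h1_def h2_def scale_map_def)
  qed
  then have "D T = scale_map scaleE (1 / 2) (D h1 + scale_map scaleE \<i> (D h2))"
    using D_scale[of "h1 + scale_map scaleE \<i> h2" "1 / 2"] D_add[of h1 "scale_map scaleE \<i> h2"] D_scale[of h2 \<i>]
      K_sub_L[OF h1] K_sub_L[OF h2] by (metis add_in_L scale_in_L)
  moreover have "scale_map scaleE (1 / 2) (D h1 + scale_map scaleE \<i> (D h2)) \<in> K_E"
    by (intro K_scale K_add selfadjoint h1 h2 s1 s2)
  ultimately show ?thesis by (simp only:)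
qed

lemma zero_if_rank_one_zero:
  assumes S: "S \<in> L_E" and "\<And>x y. S \<circ> rank_one act ip x y = 0"
  shows "S = 0"
proof
  fix x
  let ?w = "ip (S x) (S x)"
  have "S (act x ?w) = 0"
    using fun_cong[OF assms(2)[of x "S x"], of "S x"] by (simp add: rank_one_def)
  then have "ip (S x) (act (S x) ?w) = 0"
    using ip_scale_right[of "S x" 0 0] by (simp add: L_D(3)[OF S])
  then have "star ?w * ?w = 0" using ip_star[of "S x" "S x"] by (simp add: ip_act_right)
  then have "?w = 0"
  proof (intro seminorms_separate)
    fix p assume "p \<in> S_A" and w: "star ?w * ?w = 0"
    then interpret P: cauchy_schwarz_module scaleA star scaleE ip p by (intro module_S)
    have "(p ?w)\<^sup>2 = p 0" using P.p_star_mult[of ?w] w by simp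
    then show "p ?w = 0" using P.p_scale[of 0 0] by simp
  qed
  then show "S x = 0 x" using ip_eq_0_iff by simp
qed

theorem derivations_inner_if_compact:
  assumes inner: "\<And>D. derivation_on (scale_map scaleE) (\<circ>) K_E D \<Longrightarrow> inner_on (\<circ>) K_E D"
    and D: "derivation_on (scale_map scaleE) (\<circ>) L_E D"
  shows "inner_on (\<circ>) L_E D"
proof -
  have D_in: "\<And>U. U \<in> L_E \<Longrightarrow> D U \<in> L_E"
    and D_comp: "\<And>U V. U \<in> L_E \<Longrightarrow> V \<in> L_E \<Longrightarrow> D (U \<circ> V) = (D U \<circ> V) + (U \<circ> D V)"
    using D unfolding derivation_on_def by auto
  have "derivation_on (scale_map scaleE) (\<circ>) K_E D"
    using D derivation_preserves_K[OF D] K_sub_L unfolding derivation_on_def by blast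
  then obtain X where X: "X \<in> K_E" "\<And>k. k \<in> K_E \<Longrightarrow> D k = (k \<circ> X) - (X \<circ> k)"
    using inner unfolding inner_on_def by blast
  have XL: "X \<in> L_E" using X(1) by (rule K_sub_L)
  have "D T = (T \<circ> X) - (X \<circ> T)" if T: "T \<in> L_E" for T
  proof -
    define S where "S = D T - ((T \<circ> X) - (X \<circ> T))"
    have "S \<in> L_E" unfolding S_def by (intro diff_in_L D_in comp_in_L T XL)
    moreover have "S \<circ> rank_one act ip x y = 0" for x y
    proof -
      let ?k = "rank_one act ip x y"
      have k: "?k \<in> K_E" by (intro K0_sub_K F.span_base) blast
      have "D (T \<circ> ?k) = ((T \<circ> ?k) \<circ> X) - (X \<circ> (T \<circ> ?k))"
        by (intro X K_comp_left T k)
      moreover have "D (T \<circ> ?k) = (D T \<circ> ?k) + (T \<circ> ((?k \<circ> X) - (X \<circ> ?k)))"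
        using D_comp[OF T K_sub_L[OF k]] X(2)[OF k] by simp
      ultimately have eq: "(D T \<circ> ?k) + (T \<circ> ((?k \<circ> X) - (X \<circ> ?k))) = ((T \<circ> ?k) \<circ> X) - (X \<circ> (T \<circ> ?k))"
        by simp
      show ?thesis
      proof
        fix \<xi>
        have "D T (?k \<xi>) + (T (?k (X \<xi>)) - T (X (?k \<xi>))) = T (?k (X \<xi>)) - X (T (?k \<xi>))"
          using fun_cong[OF eq, of \<xi>] by (simp add: L_diff_arg[OF T])
        then have "D T (?k \<xi>) = T (X (?k \<xi>)) - X (T (?k \<xi>))" by (simp add: algebra_simps)
        then show "(S \<circ> ?k) \<xi> = 0 \<xi>" by (simp add: S_def)
      qed
    qed
    ultimately have "S = 0" by (rule zero_if_rank_one_zero)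
    then show ?thesis by (simp add: S_def)
  qed
  then show ?thesis unfolding inner_on_def using XL by blast
qed

end

theorem theorem3p1:
  fixes scaleA ::
      "complex \<Rightarrow> 'a::{ring,topological_semigroup_mult,uniform_topological_group_add,t2_space} \<Rightarrow> 'a"
    and star :: "'a \<Rightarrow> 'a"
    and scaleE :: "complex \<Rightarrow> 'e::ab_group_add \<Rightarrow> 'e"
    and act :: "'e \<Rightarrow> 'a \<Rightarrow> 'e"
    and ip :: "'e \<Rightarrow> 'e \<Rightarrow> 'a"
  assumes "right_hilbert_module scaleA star scaleE act ip"
    and "full_module scaleA ip"
    and "\<forall>D. derivation_on (scale_map scaleE) (\<circ>) (compact_operators scaleA star scaleE act ip) D \<longrightarrow>
             inner_on (\<circ>) (compact_operators scaleA star scaleE act ip) D"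
  shows "\<forall>D. derivation_on (scale_map scaleE) (\<circ>) (adjointable_operators scaleA star scaleE act ip) D \<longrightarrow>
             inner_on (\<circ>) (adjointable_operators scaleA star scaleE act ip) D"
proof (intro allI impI)
  fix D
  assume D: "derivation_on (scale_map scaleE) (\<circ>) (adjointable_operators scaleA star scaleE act ip) D"
  interpret right_hilbert_module scaleA star scaleE act ip by (rule assms(1))
  show "inner_on (\<circ>) (adjointable_operators scaleA star scaleE act ip) D"
    using derivations_inner_if_compact[OF _ D] assms(3) by blast
qed

end
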